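(* Let $a\ge1$ and $\frac1a+\frac1b=1$. Let $g:\mathbb{R}^n\to\mathbb{R}$ be Lipschitz with respect to $\|\cdot\|_a$ with Lipschitz constant $K$, and with decomposition $g(\mathbf{x})=\tilde g(\mathbf{x}^{(1)})+\boldsymbol\beta^T\mathbf{x}^{(2)}$, where $\mathbf{x}=(\mathbf{x}^{(1)},\mathbf{x}^{(2)})$, $\mathbf{x}^{(1)}\in\mathbb{R}^m$, $\mathbf{x}^{(2)}\in\mathbb{R}^{n-m}$, $m\le n$, $\boldsymbol\beta\in\mathbb{R}^{n-m}$, and $\tilde g:\mathbb{R}^m\to\mathbb{R}$ is Lipschitz with Lipschitz constant $L$. Let $\mathbf{X}\in\mathcal{L}^p_n$ with $g(\mathbf{X})\in\mathcal{L}^p$ and $\epsilon\ge0$. Assume any one of the following holds: (i) $a=1$ and $\|\boldsymbol\beta\|_\infty\ge L$; (ii) $m=0$. Then $g\big(\mathcal{U}^n_\epsilon(\mathbf{X})\big)=\mathcal{U}_{K\epsilon}(g(\mathbf{X}))$.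
   Context: Fix $p\ge 1$ and a non-atomic probability space $(\Omega,\mathcal{B},\mathbb{P})$ with $\mathcal{B}=\mathcal{B}(\mathbb{R}^n)$; all random variables/vectors live on it. $\|\mathbf{x}\|_a=(\sum_i|x_i|^a)^{1/a}$; $b=\infty$ (max norm) when $a=1$. $\mathcal{L}^p_n$ is the space of $n$-dimensional random vectors $\mathbf{X}$ with $\mathbb{E}[\|\mathbf{X}\|_a^p]<\infty$, and $\mathcal{L}^p=\mathcal{L}^p_1$. $F_{\mathbf{X}}$ is the cdf of $\mathbf{X}$. For cdfs $F,G$ on $\mathbb{R}^n$ with finite $p$-th moments, $W^n(F,G)=\inf (\mathbb{E}[\|\mathbf{X}-\mathbf{Y}\|_a^p])^{1/p}$, the infimum over all couplings $(\mathbf{X},\mathbf{Y})$ with $F_{\mathbf{X}}=F$, $F_{\mathbf{Y}}=G$. The Wasserstein uncertainty set is $\mathcal{U}^n_\epsilon(\mathbf{X})=\{\mathbf{Z}\in\mathcal{L}^p_n : W^n(F_{\mathbf{Z}},F_{\mathbf{X}})\le\epsilon\}$, with $\mathcal{U}_\epsilon=\mathcal{U}^1_\epsilon$ for univariate random variables. $g(\mathcal{U}^n_\epsilon(\mathbf{X}))=\{g(\mathbf{Z}):\mathbf{Z}\in\mathcal{U}^n_\epsilon(\mathbf{X})\}$. The Lipschitz constant of a function is the smallest constant for which the Lipschitz inequality with respect to $\|\cdot\|_a$ holds. Conventions on the decomposition: if $g$ has no linear components then $m=n$ and $\tilde g=g$ (so $\|\boldsymbol\beta\|_b=0$); otherwise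 the smallest possible $m$ is chosen; $m=0$ means $g$ is linear, $g(\mathbf{x})=\boldsymbol\beta^T\mathbf{x}$ (and $L=0$). Standing assumption: $g$ is non-constant.
   Formalization: The equality is proved up to equality in distribution: the variables with the same law as some g(Z), Z in the uncertainty set of X, are exactly U_{Kε}(g(X)); literal equality of sets of random variables on the fixed space fails, e.g. n=2, g(x)=x_1, ε=0, X uniform on the unit square. *)

theory Defs
  imports "HOL-Probability.Probability"
begin

definition nonatomic :: "'w measure \<Rightarrow> bool" where
  "nonatomic P \<longleftrightarrow>
     (\<forall>A\<in>sets P. measure P A > 0 \<longrightarrow>
        (\<exists>B\<in>sets P. B \<subseteq> A \<and> 0 < measure P B \<and> measure P B < measure P A))"

definition lnorm :: "real \<Rightarrow> real ^ 'n \<Rightarrow> real" where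
  "lnorm a x = (\<Sum>i\<in>UNIV. \<bar>x $ i\<bar> powr a) powr (1 / a)"

text \<open>
  The notions below take the norm \<open>N\<close> as a parameter, so that they apply both to random
  vectors (with \<open>N = lnorm a\<close>) and to random variables (with \<open>N = abs\<close>).
  The order on \<open>real ^ 'n\<close> is componentwise, so \<open>dist_fun P X\<close> is the joint
  distribution function of \<open>X\<close>.
\<close>

definition dist_fun :: "'w measure \<Rightarrow> ('w \<Rightarrow> 'a::ordered_euclidean_space) \<Rightarrow> 'a \<Rightarrow> real" where
  "dist_fun P X = (\<lambda>x. measure P {\<omega> \<in> space P. X \<omega> \<le> x})"

definition Lp_vars ::
  "'w measure \<Rightarrow> real \<Rightarrow> ('a::ordered_euclidean_space \<Rightarrow> real) \<Rightarrow> ('w \<Rightarrow> 'a) set" where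
  "Lp_vars P p N = {X \<in> borel_measurable P. integrable P (\<lambda>\<omega>. N (X \<omega>) powr p)}"

text \<open>
  Couplings are pairs of random vectors on the underlying space \<open>P\<close>. The Bochner integral is
  only meaningful here for \<open>F\<close> and \<open>G\<close> with finite \<open>p\<close>-th moments; then
  \<open>N (X \<omega> - Y \<omega>) powr p\<close> is integrable for every coupling.
\<close>

definition wasserstein ::
  "'w measure \<Rightarrow> real \<Rightarrow> ('a::ordered_euclidean_space \<Rightarrow> real) \<Rightarrow>
     ('a \<Rightarrow> real) \<Rightarrow> ('a \<Rightarrow> real) \<Rightarrow> real" where
  "wasserstein P p N F G =
     Inf {(\<integral>\<omega>. N (X \<omega> - Y \<omega>) powr p \<partial>P) powr (1 / p) | X Y.
            X \<in> borel_measurable P \<and> Y \<in> borel_measurable P \<and>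
            dist_fun P X = F \<and> dist_fun P Y = G}"

definition uncertainty_set ::
  "'w measure \<Rightarrow> real \<Rightarrow> ('a::ordered_euclidean_space \<Rightarrow> real) \<Rightarrow>
     real \<Rightarrow> ('w \<Rightarrow> 'a) \<Rightarrow> ('w \<Rightarrow> 'a) set" where
  "uncertainty_set P p N \<epsilon> X =
     {Z \<in> Lp_vars P p N. wasserstein P p N (dist_fun P Z) (dist_fun P X) \<le> \<epsilon>}"

text \<open>
  All random variables on \<open>P\<close> having the same distribution as some member of \<open>A\<close>.
  Wasserstein uncertainty sets only constrain distributions, and the image of one under a map is
  compared with another modulo equality in distribution. Without this closure the comparison
  fails already for \<open>\<epsilon> = 0\<close> and \<open>g x = x\<^sub>1\<close> on \<open>\<real>\<^sup>2\<close>: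
  if \<open>V\<close> is uniform on the unit interval and generates the \<open>\<sigma>\<close>-algebra, and
  \<open>X\<close> is uniform on the unit square, then no \<open>Z\<close> distributed like \<open>X\<close> has
  first coordinate \<open>V\<close>, since its second coordinate would be a function of \<open>V\<close>.
\<close>

definition law_closure ::
  "'w measure \<Rightarrow> ('w \<Rightarrow> 'a::ordered_euclidean_space) set \<Rightarrow> ('w \<Rightarrow> 'a) set" where
  "law_closure P A = {Y \<in> borel_measurable P. \<exists>Z\<in>A. dist_fun P Y = dist_fun P Z}"

text \<open>
  The bound \<open>0 \<le> C\<close> only matters when \<open>S\<close> is a single point; the Lipschitz constant is
  then \<open>0\<close>.
\<close>

definition lipschitz_bound ::
  "('a::real_vector \<Rightarrow> real) \<Rightarrow> 'a set \<Rightarrow> ('a \<Rightarrow> real) \<Rightarrow> real \<Rightarrow> bool" where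
  "lipschitz_bound N S f C \<longleftrightarrow>
     0 \<le> C \<and> (\<forall>x\<in>S. \<forall>y\<in>S. \<bar>f x - f y\<bar> \<le> C * N (x - y))"

definition is_lipschitz_constant ::
  "('a::real_vector \<Rightarrow> real) \<Rightarrow> 'a set \<Rightarrow> ('a \<Rightarrow> real) \<Rightarrow> real \<Rightarrow> bool" where
  "is_lipschitz_constant N S f K \<longleftrightarrow>
     lipschitz_bound N S f K \<and> (\<forall>C. lipschitz_bound N S f C \<longrightarrow> K \<le> C)"

text \<open>
  The splitting \<open>x = (x\<^sup>1, x\<^sup>2)\<close> of the coordinates into a block of length \<open>m\<close> and a
  block of length \<open>n - m\<close> is given by a set \<open>I\<close> of coordinates with \<open>card I = m\<close> and
  its complement; \<open>I\<close> may be empty or everything. The space \<open>\<real>\<^sup>I\<close> is identified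
  with the vectors of \<open>\<real>\<^sup>n\<close> vanishing outside \<open>I\<close>, which preserves all the norms used.
\<close>

definition coord_space :: "'n set \<Rightarrow> (real ^ 'n) set" where
  "coord_space J = {x. \<forall>i. i \<notin> J \<longrightarrow> x $ i = 0}"

definition coord_part :: "'n set \<Rightarrow> real ^ 'n \<Rightarrow> real ^ 'n" where
  "coord_part J x = (\<chi> i. if i \<in> J then x $ i else 0)"

text \<open>
  Here \<open>h\<close> is a function on \<open>\<real>\<^sup>I\<close> and \<open>\<beta>\<close> a vector of the complementary
  coordinates. Empty \<open>I\<close> is reserved for linear (not merely affine) \<open>g\<close>.
\<close>

definition decomposition ::
  "(real ^ 'n \<Rightarrow> real) \<Rightarrow> 'n set \<Rightarrow> (real ^ 'n \<Rightarrow> real) \<Rightarrow> real ^ 'n \<Rightarrow> bool" where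
  "decomposition g I h \<beta> \<longleftrightarrow>
     \<beta> \<in> coord_space (- I) \<and>
     (\<forall>x. g x = h (coord_part I x) + \<beta> \<bullet> coord_part (- I) x) \<and>
     (I = {} \<longrightarrow> h 0 = 0)"

text \<open>
  If \<open>g\<close> has no linear components, minimality forces \<open>I = UNIV\<close>, hence \<open>\<beta> = 0\<close>
  and \<open>h = g\<close>.
\<close>

definition minimal_decomposition ::
  "(real ^ 'n \<Rightarrow> real) \<Rightarrow> 'n set \<Rightarrow> (real ^ 'n \<Rightarrow> real) \<Rightarrow> real ^ 'n \<Rightarrow> bool" where
  "minimal_decomposition g I h \<beta> \<longleftrightarrow>
     decomposition g I h \<beta> \<and>
     (\<forall>J h' \<beta>'. decomposition g J h' \<beta>' \<longrightarrow> card I \<le> card J)"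

end

theory Submission
  imports Defs
begin

text \<open>
  Both cases provide a direction \<open>v\<close> of length at most \<open>1\<close> along which \<open>g\<close> grows linearly with the
  maximal slope \<open>K\<close>. Given \<open>Y\<close> within Wasserstein distance \<open>K \<epsilon>\<close> of \<open>g(X)\<close>, take copies
  \<open>X'\<close> of \<open>X\<close> and \<open>Y'\<close> of \<open>Y\<close> for which \<open>(Y', g(X'))\<close> is an optimal coupling. Then
  \<open>Z = X' + (Y' - g(X')) / K v\<close> satisfies \<open>g(Z) = Y'\<close> and lies within \<open>\<epsilon>\<close> of \<open>X\<close>.
  The other inclusion is the Lipschitz bound applied to couplings.

  In dimension one the comonotone coupling is optimal. With an independent uniform variable that splits
  the atoms, \<open>g(X)\<close> becomes a nondecreasing function of a uniform \<open>V\<close>, and \<open>Y'\<close> is the quantile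
  function of \<open>Y\<close> evaluated at \<open>V\<close>. The joint law of \<open>X\<close> and the independent variable need not
  exist over \<open>X\<close> itself, but a nonatomic Borel space carries a variable with any given law.
\<close>

section \<open>Uniform variables and transport of laws\<close>

definition ternary :: "(nat \<Rightarrow> bool) \<Rightarrow> real" where
  "ternary e = (\<Sum>i. of_bool (e i) / 3 ^ Suc i)"

lemma sums_third_powers: "(\<lambda>i. 1 / 3 ^ Suc i :: real) sums (1 / 2)"
  using sums_mult[OF geometric_sums[of "1/3::real"], of "1/3"]
  by (simp add: power_divide)

lemma summable_ternary: "summable (\<lambda>i. of_bool (e i) / 3 ^ Suc i :: real)"
  by (rule summable_comparison_test'[OF sums_summable[OF sums_third_powers], of 0]) auto

lemma ternary_bounds: "0 \<le> ternary e" "ternary e \<le> 1 / 2"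
proof -
  show "0 \<le> ternary e" unfolding ternary_def by (rule suminf_nonneg[OF summable_ternary]) auto
  have "ternary e \<le> (\<Sum>i. 1 / 3 ^ Suc i)"
    unfolding ternary_def
    by (rule suminf_le[OF _ summable_ternary sums_summable[OF sums_third_powers]]) auto
  then show "ternary e \<le> 1 / 2" using sums_unique[OF sums_third_powers] by simp
qed

lemma ternary_rec: "3 * ternary e = of_bool (e 0) + ternary (\<lambda>i. e (Suc i))"
proof -
  have "ternary e = of_bool (e 0) / 3 + (\<Sum>i. of_bool (e (Suc i)) / 3 ^ Suc (Suc i))"
    unfolding ternary_def by (subst suminf_split_head[OF summable_ternary]) simp
  also have "(\<Sum>i. of_bool (e (Suc i)) / 3 ^ Suc (Suc i)) = ternary (\<lambda>i. e (Suc i)) / 3"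
    unfolding ternary_def using suminf_divide[OF summable_ternary[of "\<lambda>i. e (Suc i)"], of 3]
    by (simp add: mult.commute)
  finally show ?thesis by simp
qed

text \<open>Multiplying by 3 shifts the digits (\<open>ternary_rec\<close>). The remaining tail is
  at most 1/2, so the floor of \<open>3 * ternary e\<close> is the leading bit. In the induction
  step the leading bit contributes a multiple of 3 to the floor, which vanishes modulo 3.\<close>

lemma floor_ternary_mod: "\<lfloor>3 ^ Suc n * ternary e\<rfloor> mod 3 = of_bool (e n)"
proof (induction n arbitrary: e)
  case 0
  have "\<lfloor>3 * ternary e\<rfloor> = of_bool (e 0)"
    unfolding ternary_rec using ternary_bounds[of "\<lambda>i. e (Suc i)"] by (auto simp: floor_eq_iff)
  then show ?case by simp
next
  case (Suc n)
  have "3 ^ Suc (Suc n) * ternary e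
      = of_int (3 ^ Suc n * of_bool (e 0)) + 3 ^ Suc n * ternary (\<lambda>i. e (Suc i))"
    using arg_cong[OF ternary_rec[of e], of "\<lambda>t. 3 ^ Suc n * t"] by (simp add: algebra_simps)
  then have "\<lfloor>3 ^ Suc (Suc n) * ternary e\<rfloor>
      = 3 * (3 ^ n * of_bool (e 0)) + \<lfloor>3 ^ Suc n * ternary (\<lambda>i. e (Suc i))\<rfloor>"
    by (simp only: floor_add2[OF disjI1[OF Ints_of_int]] floor_of_int) (simp add: mult.assoc)
  then show ?case using Suc.IH[of "\<lambda>i. e (Suc i)"] by simp
qed

text \<open>
  The bits of \<open>\<iota> x\<close> record which half-spaces with a rational bound contain \<open>x\<close>. Base three leaves
  room for the tail, so that the bits can be read off with the floor function.
\<close>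

lemma measurable_embedding_real:
  obtains \<iota> :: "'a::euclidean_space \<Rightarrow> real" and \<rho> :: "real \<Rightarrow> 'a"
  where "\<iota> \<in> borel_measurable borel" "\<rho> \<in> borel_measurable borel" "\<And>x. \<rho> (\<iota> x) = x"
proof -
  define D where "D = (Basis :: 'a set) \<times> (\<rat> :: real set)"
  define H where "H = from_nat_into D"
  have "D \<noteq> {}" unfolding D_def using Rats_0 nonempty_Basis by blast
  moreover have "countable D"
    unfolding D_def by (intro countable_SIGMA countable_rat countable_finite finite_Basis)
  ultimately have H: "range H = D" unfolding H_def by (rule range_from_nat_into)
  define \<iota> where "\<iota> x = ternary (\<lambda>n. snd (H n) < x \<bullet> fst (H n))" for x :: 'a
  define d where "d n y \<longleftrightarrow> \<lfloor>3 ^ Suc n * y\<rfloor> mod 3 = 1" for n and y :: real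
  \<comment> \<open>Recovers the coordinate in direction \<open>b\<close> as the supremum of the
    rational bounds whose bit is set. Indices of another direction or with an unset bit contribute
    minus infinity, which the supremum ignores. Extended reals keep \<open>s\<close> total, so
    \<open>\<rho>\<close> is also defined at reals that encode no vector.\<close>
  define s where "s b y = (SUP n. if fst (H n) = b \<and> d n y then ereal (snd (H n)) else -\<infinity>)" for b y
  define \<rho> where "\<rho> y = (\<Sum>b\<in>Basis. real_of_ereal (s b y) *\<^sub>R b)" for y
  have "\<iota> \<in> borel_measurable borel"
    unfolding \<iota>_def ternary_def of_bool_def
    by (intro borel_measurable_suminf borel_measurable_divide measurable_If) measurable
  moreover have "\<rho> \<in> borel_measurable borel"
  proof -
    have [measurable]: "Measurable.pred borel (d n)" for n
    proof -
      have "(\<lambda>y::real. \<lfloor>3 ^ Suc n * y\<rfloor>) \<in> measurable borel (count_space UNIV)"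
        by measurable
      from measurable_compose[OF this, of "\<lambda>k. k mod 3 = 1" "count_space UNIV"]
      show ?thesis unfolding d_def by simp
    qed
    have "s b \<in> borel_measurable borel" for b
      unfolding s_def by (intro borel_measurable_SUP measurable_If) auto
    then show ?thesis
      unfolding \<rho>_def by (intro borel_measurable_sum borel_measurable_scaleR) auto
  qed
  moreover have "\<rho> (\<iota> x) = x" for x
  proof -
    have d: "d n (\<iota> x) \<longleftrightarrow> snd (H n) < x \<bullet> fst (H n)" for n
      unfolding d_def \<iota>_def floor_ternary_mod by simp
    have "s b (\<iota> x) = ereal (x \<bullet> b)" if b: "b \<in> Basis" for b
    proof (rule antisym)
      show "s b (\<iota> x) \<le> ereal (x \<bullet> b)"
        unfolding s_def d by (rule SUP_least) auto
      show "ereal (x \<bullet> b) \<le> s b (\<iota> x)"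
      proof (rule ccontr)
        assume "\<not> ?thesis"
        then obtain r :: rat where r: "s b (\<iota> x) < ereal (of_rat r)" "ereal (of_rat r) < ereal (x \<bullet> b)"
          using ereal_dense3[of "s b (\<iota> x)" "ereal (x \<bullet> b)"] by (auto simp: not_le)
        have "(b, of_rat r) \<in> range H" using b by (auto simp: H D_def)
        then obtain n where n: "H n = (b, of_rat r)" by force
        have "(if fst (H n) = b \<and> d n (\<iota> x) then ereal (snd (H n)) else -\<infinity>) \<le> s b (\<iota> x)"
          unfolding s_def by (rule SUP_upper) simp
        then show False using r by (simp add: d n)
      qed
    qed
    then have "\<rho> (\<iota> x) = (\<Sum>b\<in>Basis. (x \<bullet> b) *\<^sub>R b)"
      unfolding \<rho>_def by (intro sum.cong) auto
    then show ?thesis by (simp add: euclidean_representation)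
  qed
  ultimately show ?thesis by (rule that)
qed

text \<open>
  \<open>V\<close> interpolates between the left limit and the value of the distribution function at \<open>G\<close>, and
  \<open>u\<close> spreads each atom of \<open>G\<close> uniformly over the corresponding jump.
\<close>

lemma (in prob_space) distributional_transform:
  fixes G u :: "'a \<Rightarrow> real"
  assumes [measurable]: "G \<in> borel_measurable M" "u \<in> borel_measurable M"
    and u: "AE \<omega> in M. 0 \<le> u \<omega> \<and> u \<omega> \<le> 1"
    and indep: "\<And>q c. 0 \<le> c \<Longrightarrow> c \<le> 1 \<Longrightarrow>
      prob {\<omega>\<in>space M. G \<omega> = q \<and> u \<omega> \<le> c} = c * prob {\<omega>\<in>space M. G \<omega> = q}"
  obtains V where "V \<in> borel_measurable M"
    "\<And>v. 0 \<le> v \<Longrightarrow> v \<le> 1 \<Longrightarrow> prob {\<omega>\<in>space M. V \<omega> \<le> v} = v"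
    "AE \<omega> in M. \<forall>s. G \<omega> \<le> s \<longrightarrow> V \<omega> \<le> prob {\<omega>\<in>space M. G \<omega> \<le> s}"
proof -
  define F where "F s = prob {\<omega>\<in>space M. G \<omega> \<le> s}" for s
  define E where "E s = prob {\<omega>\<in>space M. G \<omega> < s}" for s
  define V where "V \<omega> = E (G \<omega>) + u \<omega> * (F (G \<omega>) - E (G \<omega>))" for \<omega>
  have F_mono: "F s \<le> F t" if "s \<le> t" for s t
    unfolding F_def using that by (intro finite_measure_mono) auto
  have E_mono: "E s \<le> E t" if "s \<le> t" for s t
    unfolding E_def using that by (intro finite_measure_mono) auto
  have FE: "F s \<le> E t" if "s < t" for s t
    unfolding E_def F_def using that by (intro finite_measure_mono) auto
  have jump: "F s = E s + prob {\<omega>\<in>space M. G \<omega> = s}" for s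
    unfolding E_def F_def by (subst finite_measure_Union[symmetric]) (auto intro!: arg_cong[where f=prob])
  have [measurable]: "F \<in> borel_measurable borel" "E \<in> borel_measurable borel"
    by (auto intro!: borel_measurable_mono monoI F_mono E_mono)
  have V_meas[measurable]: "V \<in> borel_measurable M" unfolding V_def by measurable
  have V_bounds: "AE \<omega> in M. E (G \<omega>) \<le> V \<omega> \<and> V \<omega> \<le> F (G \<omega>)"
    using u
  proof eventually_elim
    case (elim \<omega>)
    have "0 \<le> F (G \<omega>) - E (G \<omega>)" by (simp add: jump)
    then show ?case using elim mult_left_le_one_le[of "F (G \<omega>) - E (G \<omega>)" "u \<omega>"]
      by (auto simp: V_def)
  qed
  interpret D: cdf_distribution "distr M borel G"
    unfolding cdf_distribution_def by (rule real_distribution_distr) simp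
  have cdf: "cdf (distr M borel G) = F"
    by (auto simp: cdf_def F_def measure_distr fun_eq_iff intro!: arg_cong[where f=prob])
  \<comment> \<open>The generalized inverse of \<open>F\<close> at \<open>v\<close> serves as
    \<open>q\<close>. To its left \<open>F\<close> stays below \<open>v\<close> by the Galois
    connection \<open>piv\<close>, and the left limit of \<open>F\<close> there is
    \<open>E q\<close>.\<close>
  have quantile: "\<exists>q. E q \<le> v \<and> v \<le> F q \<and> (\<forall>s<q. F s < v)" if v: "0 < v" "v < 1" for v
  proof -
    let ?q = "Inf {x. v \<le> F x}"
    have piv: "v \<le> F x \<longleftrightarrow> ?q \<le> x" for x
      using D.pseudoinverse[of v x] v unfolding cdf by simp
    have "(F \<longlongrightarrow> E ?q) (at_left ?q)"
      using D.cdf_at_left[of ?q] unfolding cdf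
      by (simp add: measure_distr E_def vimage_def Int_def conj_commute)
    moreover have "\<forall>\<^sub>F x in at_left ?q. F x \<le> v"
      unfolding eventually_at_filter
    proof (intro always_eventually allI impI)
      fix x assume "x \<in> {..<?q}"
      then have "\<not> v \<le> F x" using piv[of x] by simp
      then show "F x \<le> v" by simp
    qed
    ultimately have "E ?q \<le> v" by (rule tendsto_upperbound) simp
    then show ?thesis using piv by (meson not_le order_refl)
  qed
  have bounds: "v \<le> prob {\<omega>\<in>space M. V \<omega> \<le> v} \<and> prob {\<omega>\<in>space M. V \<omega> < v} \<le> v"
    if v: "0 < v" "v < 1" for v
  proof -
    obtain q where q: "E q \<le> v" "v \<le> F q" "\<And>s. s < q \<Longrightarrow> F s < v"
      using quantile[OF v] by blast
    \<comment> \<open>The fraction of the jump at \<open>q\<close> that lies below level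
      \<open>v\<close>. Without a jump, \<open>v = E q\<close> and division by zero gives
      \<open>c = 0\<close>, so \<open>c * (F q - E q) = v - E q\<close> still holds.\<close>
    define c where "c = (v - E q) / (F q - E q)"
    have c: "0 \<le> c" "c \<le> 1" "c * (F q - E q) = v - E q"
      using q by (auto simp: c_def divide_le_eq_1)
    \<comment> \<open>By \<open>indep\<close> this event has probability exactly \<open>v\<close>.
      Up to null sets it contains the event \<open>V < v\<close> and is contained in the event
      \<open>V \<le> v\<close>.\<close>
    let ?A = "{\<omega>\<in>space M. G \<omega> < q} \<union> {\<omega>\<in>space M. G \<omega> = q \<and> u \<omega> \<le> c}"
    have A: "prob ?A = v"
      using c jump[of q]
      by (subst finite_measure_Union) (auto simp: indep E_def[symmetric])
    have "prob ?A \<le> prob {\<omega>\<in>space M. V \<omega> \<le> v}"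
    proof (rule finite_measure_mono_AE)
      show "AE \<omega> in M. \<omega> \<in> ?A \<longrightarrow> \<omega> \<in> {\<omega>\<in>space M. V \<omega> \<le> v}"
        using V_bounds
      proof eventually_elim
        case (elim \<omega>)
        have "V \<omega> \<le> v" if "G \<omega> = q" "u \<omega> \<le> c"
          using mult_right_mono[OF that(2), of "F q - E q"] c(3) that(1) q(1,2) by (simp add: V_def)
        moreover have "V \<omega> \<le> v" if "G \<omega> < q" using q(3)[OF that] elim by simp
        ultimately show ?case by auto
      qed
    qed simp
    moreover have "prob {\<omega>\<in>space M. V \<omega> < v} \<le> prob ?A"
    proof (rule finite_measure_mono_AE)
      show "AE \<omega> in M. \<omega> \<in> {\<omega>\<in>space M. V \<omega> < v} \<longrightarrow> \<omega> \<in> ?A"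
        using V_bounds
      proof eventually_elim
        case (elim \<omega>)
        have "u \<omega> \<le> c" if "G \<omega> = q" "V \<omega> < v"
        proof (rule ccontr)
          assume "\<not> u \<omega> \<le> c"
          then have "c * (F q - E q) \<le> u \<omega> * (F q - E q)"
            using q by (intro mult_right_mono) auto
          then show False using that c(3) by (simp add: V_def)
        qed
        moreover have "\<not> V \<omega> < v" if "q < G \<omega>" using FE[OF that] elim q by simp
        ultimately show ?case using linorder_cases[of "G \<omega>" q] by auto
      qed
    qed simp
    ultimately show ?thesis unfolding A by simp
  qed
  \<comment> \<open>\<open>bounds\<close> controls only the strict event from above. Using it at
    every \<open>w > v\<close> and letting \<open>w\<close> tend to \<open>v\<close> covers the
    nonstrict one.\<close>
  have upper: "prob {\<omega>\<in>space M. V \<omega> \<le> v} \<le> v" if v: "0 \<le> v" "v < 1" for v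
  proof (rule dense_ge_bounded[OF v(2)])
    fix w assume w: "v < w" "w < 1"
    have "prob {\<omega>\<in>space M. V \<omega> \<le> v} \<le> prob {\<omega>\<in>space M. V \<omega> < w}"
      using w by (intro finite_measure_mono) auto
    then show "prob {\<omega>\<in>space M. V \<omega> \<le> v} \<le> w" using bounds[of w] v w by simp
  qed
  have "prob {\<omega>\<in>space M. V \<omega> \<le> v} = v" if v: "0 \<le> v" "v \<le> 1" for v
  proof (cases "v = 0 \<or> v = 1")
    case False
    then show ?thesis using bounds[of v] upper[of v] v by simp
  next
    case True
    \<comment> \<open>The endpoints lie outside the range of \<open>bounds\<close>. At 1 the claim
      follows from \<open>V \<le> F (G \<omega>) \<le> 1\<close>, at 0 from
      \<open>upper\<close>.\<close>
    have "prob {\<omega>\<in>space M. V \<omega> \<le> 1} = 1"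
    proof (subst prob_Collect_eq_1)
      show "AE \<omega> in M. V \<omega> \<le> 1"
        using V_bounds by eventually_elim (auto simp: F_def intro: order_trans[OF _ prob_le_1])
    qed simp
    then show ?thesis using upper[of 0] True measure_nonneg[of M "{\<omega>\<in>space M. V \<omega> \<le> 0}"] by auto
  qed
  moreover have "AE \<omega> in M. \<forall>s. G \<omega> \<le> s \<longrightarrow> V \<omega> \<le> prob {\<omega>\<in>space M. G \<omega> \<le> s}"
    using V_bounds
  proof eventually_elim
    case (elim \<omega>)
    then show ?case unfolding F_def[symmetric] using F_mono by (meson order_trans)
  qed
  ultimately show ?thesis using that V_meas by blast
qed

text \<open>Lower orthants are closed under intersection (through \<open>inf\<close>) and generate
  the Borel sets, and those at multiples of \<open>One\<close> exhaust the space. Hence a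
  distribution function determines the law.\<close>

lemma distr_eqI_dist_fun:
  fixes X :: "'w \<Rightarrow> 'a::ordered_euclidean_space" and Y :: "'v \<Rightarrow> 'a"
  assumes "prob_space M" "prob_space N"
    and [measurable]: "X \<in> borel_measurable M" "Y \<in> borel_measurable N"
    and eq: "dist_fun M X = dist_fun N Y"
  shows "distr M borel X = distr N borel Y"
proof -
  interpret M: prob_space M by fact
  interpret N: prob_space N by fact
  have emeasure: "emeasure (distr M borel X) {..a} = emeasure (distr N borel Y) {..a}" for a
    using fun_cong[OF eq, of a]
    by (simp add: emeasure_distr M.emeasure_eq_measure N.emeasure_eq_measure dist_fun_def
        vimage_def Int_def conj_commute)
  show ?thesis
  proof (rule measure_eqI_generator_eq[where \<Omega>=UNIV and E="range atMost"
        and A="\<lambda>n::nat. {..real n *\<^sub>R One}"])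
    show "Int_stable (range (atMost :: 'a \<Rightarrow> 'a set))"
    proof (rule Int_stableI_image)
      fix a b :: 'a
      show "\<exists>c\<in>UNIV. {..a} \<inter> {..b} = {..c}" by (intro bexI[of _ "inf a b"]) auto
    qed
    show "(\<Union>n. {..real n *\<^sub>R One}) = (UNIV :: 'a set)"
    proof (intro set_eqI iffI UNIV_I)
      fix x :: 'a
      obtain n :: nat where "norm x \<le> n" using real_arch_simple by blast
      then have "x \<bullet> b \<le> n" if "b \<in> Basis" for b
        using Basis_le_norm[OF that, of x] by simp
      then have "x \<le> real n *\<^sub>R One"
        unfolding eucl_le[of x] by (simp add: inner_sum_left_Basis)
      then show "x \<in> (\<Union>n. {..real n *\<^sub>R One})" by auto
    qed
    show "sets (distr M borel X) = sigma_sets UNIV (range atMost)"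
      "sets (distr N borel Y) = sigma_sets UNIV (range atMost)"
      by (simp_all add: borel_eq_atMost)
    show "emeasure (distr M borel X) {..real n *\<^sub>R One} \<noteq> \<infinity>" for n
      by (simp add: emeasure_distr M.emeasure_eq_measure)
  qed (use emeasure in auto)
qed

lemma dist_fun_eqI_distr:
  fixes X :: "'w \<Rightarrow> 'a::ordered_euclidean_space" and Y :: "'v \<Rightarrow> 'a"
  assumes [measurable]: "X \<in> borel_measurable M" "Y \<in> borel_measurable N"
    and eq: "distr M borel X = distr N borel Y"
  shows "dist_fun M X = dist_fun N Y"
proof
  fix a
  have "measure (distr M borel X) {..a} = measure (distr N borel Y) {..a}" by (simp add: eq)
  then show "dist_fun M X a = dist_fun N Y a"
    by (simp add: measure_distr dist_fun_def vimage_def Int_def conj_commute)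
qed

text \<open>\<open>Q\<close> is the generalized inverse of the distribution function, and the
  equivalence in the second conclusion is the Galois connection between the two. It yields the law
  of \<open>Q (V \<omega>)\<close>, and comonotonicity is later read off from it.\<close>

lemma (in prob_space) quantile_transform:
  fixes V :: "'a \<Rightarrow> real" and D :: "real measure"
  assumes [measurable]: "V \<in> borel_measurable M" and "real_distribution D"
    and uniform: "\<And>v. 0 \<le> v \<Longrightarrow> v \<le> 1 \<Longrightarrow> prob {\<omega>\<in>space M. V \<omega> \<le> v} = v"
  obtains Q where "Q \<in> borel_measurable borel"
    "AE \<omega> in M. \<forall>s. Q (V \<omega>) \<le> s \<longleftrightarrow> V \<omega> \<le> cdf D s"
    "distr M borel (\<lambda>\<omega>. Q (V \<omega>)) = D"
proof -
  interpret D: cdf_distribution D unfolding cdf_distribution_def by fact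
  \<comment> \<open>Outside the open unit interval the infimum may range over an empty set or one
    unbounded below. The value 0 there is arbitrary, since \<open>V\<close> almost surely lies
    strictly between 0 and 1.\<close>
  define Q where "Q y = (if y \<in> {0<..<1} then Inf {x. y \<le> cdf D x} else 0)" for y
  have Q[measurable]: "Q \<in> borel_measurable borel"
    unfolding Q_def using D.measurable_CI
    by (subst measurable_If_restrict_space_iff) (auto simp: greaterThanLessThan_eq greaterThan_def lessThan_def Int_def)
  have "AE \<omega> in M. \<not> V \<omega> \<le> 0"
    using prob_Collect_eq_0[of "\<lambda>\<omega>. V \<omega> \<le> 0"] uniform[of 0] by simp
  moreover have "AE \<omega> in M. V \<omega> < 1"
  proof -
    have "1 \<le> prob {\<omega>\<in>space M. V \<omega> < 1}"
    proof (rule dense_le_bounded[of 0])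
      fix v :: real assume v: "0 < v" "v < 1"
      have "prob {\<omega>\<in>space M. V \<omega> \<le> v} \<le> prob {\<omega>\<in>space M. V \<omega> < 1}"
        using v by (intro finite_measure_mono) auto
      then show "v \<le> prob {\<omega>\<in>space M. V \<omega> < 1}" using uniform[of v] v by simp
    qed simp
    then have "prob {\<omega>\<in>space M. V \<omega> < 1} = 1" by (intro antisym prob_le_1)
    then show ?thesis by (subst (asm) prob_Collect_eq_1) auto
  qed
  ultimately have AE: "AE \<omega> in M. \<forall>s. Q (V \<omega>) \<le> s \<longleftrightarrow> V \<omega> \<le> cdf D s"
    by eventually_elim (simp add: Q_def D.pseudoinverse[symmetric])
  have "distr M borel (\<lambda>\<omega>. Q (V \<omega>)) = D"
  proof (rule cdf_unique)
    show "cdf (distr M borel (\<lambda>\<omega>. Q (V \<omega>))) = cdf D"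
    proof
      fix s
      have "cdf (distr M borel (\<lambda>\<omega>. Q (V \<omega>))) s = prob {\<omega>\<in>space M. Q (V \<omega>) \<le> s}"
        by (auto simp: cdf_def measure_distr intro!: arg_cong[where f=prob])
      also have "\<dots> = prob {\<omega>\<in>space M. V \<omega> \<le> cdf D s}"
        by (rule finite_measure_eq_AE) (use AE in auto)
      also have "\<dots> = cdf D s"
        by (intro uniform D.cdf_nonneg D.cdf_bounded_prob)
      finally show "cdf (distr M borel (\<lambda>\<omega>. Q (V \<omega>))) s = cdf D s" .
    qed
  qed (auto intro: assms real_distribution_distr)
  then show ?thesis using that Q AE by blast
qed

section \<open>Variables with a prescribed law on a nonatomic space\<close>

lemma nonatomic_singleton:
  assumes "sets P = sets borel" "nonatomic P"
  shows "measure P {x :: 'a::t1_space} = 0"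
proof (rule ccontr)
  assume "measure P {x} \<noteq> 0"
  moreover have "{x} \<in> sets P" using assms by simp
  ultimately obtain B where "B \<subseteq> {x}" "0 < measure P B" "measure P B < measure P {x}"
    using assms(2) unfolding nonatomic_def by (metis measure_nonneg order_le_less)
  then show False using subset_singletonD by fastforce
qed

text \<open>The embedding \<open>\<iota>\<close> turns \<open>P\<close> into an atomless law on the
  line, the distributional transform turns this into a uniform \<open>V\<close>, the quantile
  function turns \<open>V\<close> into a variable with the law of \<open>j\<close> under
  \<open>D\<close>, and the decoder \<open>r\<close> recovers \<open>D\<close>.\<close>

lemma nonatomic_realizes_distribution:
  fixes P :: "'b::euclidean_space measure" and D :: "'a::euclidean_space measure"
  assumes "prob_space P" and sets_P: "sets P = sets borel" and "nonatomic P"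
    and "prob_space D" and sets_D: "sets D = sets borel"
  obtains T where "T \<in> borel_measurable P" "distr P borel T = D"
proof -
  interpret P: prob_space P by fact
  interpret D: prob_space D by fact
  obtain \<iota> :: "'b \<Rightarrow> real" and \<rho>
    where \<iota>: "\<iota> \<in> borel_measurable borel" and \<rho>\<iota>: "\<And>x. \<rho> (\<iota> x) = x"
    using measurable_embedding_real by metis
  have \<iota>_P: "\<iota> \<in> borel_measurable P"
    using \<iota> measurable_cong_sets[OF sets_P refl] by blast
  have "P.prob {\<omega>\<in>space P. \<iota> \<omega> = q} = 0" for q
  proof -
    \<comment> \<open>Since \<open>\<rho>\<close> inverts \<open>\<iota>\<close>, the level set at
      \<open>q\<close> contains at most the point \<open>\<rho> q\<close>.\<close>
    have "P.prob {\<omega>\<in>space P. \<iota> \<omega> = q} \<le> P.prob {\<rho> q}"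
      using sets_P \<rho>\<iota> by (intro P.finite_measure_mono) auto
    then show ?thesis
      using nonatomic_singleton[OF sets_P \<open>nonatomic P\<close>] by (simp add: measure_le_0_iff)
  qed
  \<comment> \<open>There are no atoms to split: both sides are 0, so the constant 0 can act as the
    splitting variable.\<close>
  then have indep: "P.prob {\<omega>\<in>space P. \<iota> \<omega> = q \<and> 0 \<le> c} = c * P.prob {\<omega>\<in>space P. \<iota> \<omega> = q}"
    if "0 \<le> c" "c \<le> 1" for q c :: real
    using that by simp
  obtain V where V[measurable]: "V \<in> borel_measurable P"
    and uniform: "\<And>v. 0 \<le> v \<Longrightarrow> v \<le> 1 \<Longrightarrow> P.prob {\<omega>\<in>space P. V \<omega> \<le> v} = v"
    using P.distributional_transform[of \<iota> "\<lambda>_. 0", OF \<iota>_P _ _ indep] by auto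
  obtain j :: "'a \<Rightarrow> real" and r
    where j[measurable]: "j \<in> borel_measurable borel"
      and r[measurable]: "r \<in> borel_measurable borel" and rj: "\<And>x. r (j x) = x"
    using measurable_embedding_real by metis
  have j_D[measurable]: "j \<in> borel_measurable D"
    using j measurable_cong_sets[OF sets_D refl] by blast
  obtain Q where Q[measurable]: "Q \<in> borel_measurable borel"
    and dQ: "distr P borel (\<lambda>\<omega>. Q (V \<omega>)) = distr D borel j"
    using P.quantile_transform[OF V D.real_distribution_distr[OF j_D] uniform] by blast
  have "distr P borel (\<lambda>\<omega>. r (Q (V \<omega>))) = distr (distr P borel (\<lambda>\<omega>. Q (V \<omega>))) borel r"
    by (simp add: distr_distr comp_def)
  also have "\<dots> = distr D borel (\<lambda>x. x)"
    by (simp add: dQ distr_distr comp_def rj)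
  also have "\<dots> = D" using sets_D by (intro distr_id2) simp
  finally show ?thesis using that[of "\<lambda>\<omega>. r (Q (V \<omega>))"] by simp
qed

text \<open>For measurable \<open>A\<close> and \<open>B\<close> on a probability space this says
  that the joint distribution function is the minimum of the marginal ones, the Frechet-Hoeffding
  upper bound. The form with nested sublevel sets suits variables driven by a common uniform
  one.\<close>

definition comonotone :: "'w measure \<Rightarrow> ('w \<Rightarrow> real) \<Rightarrow> ('w \<Rightarrow> real) \<Rightarrow> bool" where
  "comonotone P A B \<longleftrightarrow> (\<forall>s t. (AE \<omega> in P. A \<omega> \<le> s \<longrightarrow> B \<omega> \<le> t) \<or> (AE \<omega> in P. B \<omega> \<le> t \<longrightarrow> A \<omega> \<le> s))"

text \<open>The sublevel sets of \<open>g (X' \<omega>)\<close> and of \<open>Y'\<close> are, up to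
  null sets, sublevel sets of one uniform \<open>V\<close>, and those form a chain. Copying the
  whole vector \<open>X\<close>, and not only \<open>g (X \<omega>)\<close>, keeps a point
  \<open>X' \<omega>\<close> that can later be moved.\<close>

lemma comonotone_coupling:
  fixes P :: "'b::euclidean_space measure" and X :: "'b \<Rightarrow> 'a::euclidean_space"
    and Y :: "'b \<Rightarrow> real" and g :: "'a \<Rightarrow> real"
  assumes "prob_space P" and sets_P: "sets P = sets borel" and "nonatomic P"
    and [measurable]: "X \<in> borel_measurable P" "Y \<in> borel_measurable P" "g \<in> borel_measurable borel"
  obtains X' Y' where "X' \<in> borel_measurable P" "Y' \<in> borel_measurable P"
    "distr P borel X' = distr P borel X" "distr P borel Y' = distr P borel Y"
    "comonotone P Y' (\<lambda>\<omega>. g (X' \<omega>))"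
proof -
  interpret P: prob_space P by fact
  define U where "U = uniform_measure lborel {0..1::real}"
  define D where "D = distr P borel X \<Otimes>\<^sub>M U"
  interpret U: prob_space U unfolding U_def by (rule prob_space_uniform_measure) auto
  interpret X: prob_space "distr P borel X" by (rule P.prob_space_distr) simp
  interpret XU: pair_prob_space "distr P borel X" U ..
  have sets_U[measurable_cong]: "sets U = sets borel" by (simp add: U_def)
  have sets_D: "sets D = sets borel"
    unfolding D_def by (subst borel_prod[symmetric]) (rule sets_pair_measure_cong, auto simp: sets_U)
  have "prob_space D" unfolding D_def by (rule XU.prob_space_axioms)
  then obtain T where T[measurable]: "T \<in> borel_measurable P" and dT: "distr P borel T = D"
    using nonatomic_realizes_distribution[OF assms(1-3) _ sets_D] by blast
  define X' where "X' \<omega> = fst (T \<omega>)" for \<omega>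
  define u where "u \<omega> = snd (T \<omega>)" for \<omega>
  have T2: "T \<in> measurable P (borel \<Otimes>\<^sub>M borel)" using T by (simp add: borel_prod)
  have X'[measurable]: "X' \<in> borel_measurable P" and u[measurable]: "u \<in> borel_measurable P"
    unfolding X'_def u_def using measurable_compose[OF T2 measurable_fst]
      measurable_compose[OF T2 measurable_snd] by auto
  \<comment> \<open>Rectangles suffice: \<open>B = UNIV\<close> gives the law of \<open>X'\<close>,
    \<open>A = UNIV\<close> the range of \<open>u\<close>, and the fiber of \<open>g\<close> over
    \<open>q\<close> with \<open>B = {..c}\<close> the splitting condition.\<close>
  have joint: "P.prob {\<omega>\<in>space P. X' \<omega> \<in> A \<and> u \<omega> \<in> B} = measure P (X -` A \<inter> space P) * measure U B"
    if A[measurable]: "A \<in> sets borel" and B[measurable]: "B \<in> sets borel" for A B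
  proof -
    have AB: "A \<times> B \<in> sets borel" by (rule borel_Times[OF A B])
    have "P.prob {\<omega>\<in>space P. X' \<omega> \<in> A \<and> u \<omega> \<in> B} = measure (distr P borel T) (A \<times> B)"
      unfolding measure_distr[OF T AB] X'_def u_def
      by (rule arg_cong[where f=P.prob]) (auto simp: mem_Times_iff)
    also have "\<dots> = measure (distr P borel X) A * measure U B"
      unfolding dT D_def measure_def using A B
      by (subst U.emeasure_pair_measure_Times) (auto simp: sets_U enn2real_mult)
    finally show ?thesis by (simp add: measure_distr)
  qed
  have X'_distr: "distr P borel X' = distr P borel X"
  proof (rule measure_eqI)
    fix A assume "A \<in> sets (distr P borel X')"
    then have [measurable]: "A \<in> sets borel" by simp
    have "P.prob {\<omega>\<in>space P. X' \<omega> \<in> A \<and> u \<omega> \<in> UNIV} = measure P (X -` A \<inter> space P)"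
      using U.prob_space by (subst joint) (auto simp: U_def)
    then show "emeasure (distr P borel X') A = emeasure (distr P borel X) A"
      by (simp add: emeasure_distr P.emeasure_eq_measure vimage_def Int_def conj_commute)
  qed simp
  have U_atMost: "measure U {..c} = c" if "0 \<le> c" "c \<le> 1" for c
  proof -
    have "{0..1} \<inter> {..c} = {0..c}" using that by auto
    then show ?thesis using that by (simp add: U_def measure_uniform_measure)
  qed
  have X'_prob: "P.prob {\<omega>\<in>space P. X' \<omega> \<in> A} = measure P (X -` A \<inter> space P)" if "A \<in> sets borel" for A
    using arg_cong[OF X'_distr, of "\<lambda>M. measure M A"] that
    by (simp add: measure_distr vimage_def Int_def conj_commute)
  have "P.prob {\<omega>\<in>space P. u \<omega> \<in> {0..1}} = 1"
    using joint[of UNIV "{0..1}"] P.prob_space by (simp add: U_def measure_uniform_measure)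
  then have u01: "AE \<omega> in P. 0 \<le> u \<omega> \<and> u \<omega> \<le> 1"
    by (subst (asm) P.prob_Collect_eq_1) auto
  have indep: "P.prob {\<omega>\<in>space P. g (X' \<omega>) = q \<and> u \<omega> \<le> c} = c * P.prob {\<omega>\<in>space P. g (X' \<omega>) = q}"
    if "0 \<le> c" "c \<le> 1" for q c
  proof -
    have [measurable]: "g -` {q} \<in> sets borel" using measurable_sets[of g borel borel "{q}"] by simp
    show ?thesis
      using joint[of "g -` {q}" "{..c}"] X'_prob[of "g -` {q}"] U_atMost[OF that] by simp
  qed
  obtain V where V[measurable]: "V \<in> borel_measurable P"
    and uniform: "\<And>v. 0 \<le> v \<Longrightarrow> v \<le> 1 \<Longrightarrow> P.prob {\<omega>\<in>space P. V \<omega> \<le> v} = v"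
    and VG: "AE \<omega> in P. \<forall>s. g (X' \<omega>) \<le> s \<longrightarrow> V \<omega> \<le> P.prob {\<omega>\<in>space P. g (X' \<omega>) \<le> s}"
    using P.distributional_transform[of "\<lambda>\<omega>. g (X' \<omega>)" u, OF _ u u01 indep] by auto
  obtain Q where Q[measurable]: "Q \<in> borel_measurable borel"
    and QV: "AE \<omega> in P. \<forall>s. Q (V \<omega>) \<le> s \<longleftrightarrow> V \<omega> \<le> cdf (distr P borel Y) s"
    and dQ: "distr P borel (\<lambda>\<omega>. Q (V \<omega>)) = distr P borel Y"
    using P.quantile_transform[OF V P.real_distribution_distr[OF \<open>Y \<in> borel_measurable P\<close>] uniform]
    by blast
  define F where "F s = P.prob {\<omega>\<in>space P. g (X' \<omega>) \<le> s}" for s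
  \<comment> \<open>One inclusion is \<open>VG\<close>. Both events have probability
    \<open>F t\<close> because \<open>V\<close> is uniform, so their difference is null.\<close>
  have VG_eq: "AE \<omega> in P. g (X' \<omega>) \<le> t \<longleftrightarrow> V \<omega> \<le> F t" for t
  proof -
    have "P.prob {\<omega>\<in>space P. V \<omega> \<le> F t \<and> \<not> g (X' \<omega>) \<le> t}
        = P.prob ({\<omega>\<in>space P. V \<omega> \<le> F t} - {\<omega>\<in>space P. g (X' \<omega>) \<le> t \<and> V \<omega> \<le> F t})"
      by (rule arg_cong[where f=P.prob]) auto
    also have "\<dots> = F t - P.prob {\<omega>\<in>space P. g (X' \<omega>) \<le> t \<and> V \<omega> \<le> F t}"
      by (subst P.finite_measure_Diff) (auto simp: uniform F_def)
    also have "P.prob {\<omega>\<in>space P. g (X' \<omega>) \<le> t \<and> V \<omega> \<le> F t} = F t"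
      unfolding F_def[of t] by (rule P.finite_measure_eq_AE) (use VG in \<open>auto simp: F_def\<close>)
    finally have "AE \<omega> in P. \<not> (V \<omega> \<le> F t \<and> \<not> g (X' \<omega>) \<le> t)"
      by (subst (asm) diff_self, subst (asm) P.prob_Collect_eq_0) auto
    with VG show ?thesis by eventually_elim (auto simp: F_def)
  qed
  have "comonotone P (\<lambda>\<omega>. Q (V \<omega>)) (\<lambda>\<omega>. g (X' \<omega>))"
    unfolding comonotone_def
  proof (intro allI)
    fix s t
    consider "cdf (distr P borel Y) s \<le> F t" | "F t \<le> cdf (distr P borel Y) s" by linarith
    then show "(AE \<omega> in P. Q (V \<omega>) \<le> s \<longrightarrow> g (X' \<omega>) \<le> t) \<or> (AE \<omega> in P. g (X' \<omega>) \<le> t \<longrightarrow> Q (V \<omega>) \<le> s)"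
    proof cases
      case 1
      have "AE \<omega> in P. Q (V \<omega>) \<le> s \<longrightarrow> g (X' \<omega>) \<le> t"
        using QV VG_eq[of t] by eventually_elim (use 1 in auto)
      then show ?thesis ..
    next
      case 2
      have "AE \<omega> in P. g (X' \<omega>) \<le> t \<longrightarrow> Q (V \<omega>) \<le> s"
        using QV VG_eq[of t] by eventually_elim (use 2 in auto)
      then show ?thesis ..
    qed
  qed
  then show ?thesis using that[OF X' _ X'_distr dQ] by simp
qed

section \<open>Optimality of the comonotone coupling\<close>

text \<open>
  The measure is the second derivative of \<open>\<bar>z\<bar> powr p\<close> on the nonnegative half-line; for \<open>p = 1\<close> it
  is half of the atom at the origin.
  The function \<open>ennreal\<close> cuts off at zero, so the integrand is the sum of two positive parts.
\<close>

lemma powr_layers: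
  assumes "1 \<le> p"
  obtains m where "sigma_finite_measure m" "sets m = sets borel"
    "\<And>z. ennreal (\<bar>z\<bar> powr p) = (\<integral>\<^sup>+w. ennreal (z - w) + ennreal (- z - w) \<partial>m)"
proof (cases "p = 1")
  case True
  show ?thesis
  proof
    interpret prob_space "return borel (0::real)" by (rule prob_space_return) simp
    show "sigma_finite_measure (return borel (0::real))" ..
    show "ennreal (\<bar>z\<bar> powr p) = (\<integral>\<^sup>+w. ennreal (z - w) + ennreal (- z - w) \<partial>return borel 0)" for z
      by (subst nn_integral_return) (auto simp: True abs_if ennreal_neg)
  qed simp
next
  case False
  with assms have p: "1 < p" by simp
  define f where "f w = ennreal (p * (p - 1) * w powr (p - 2)) * indicator {0..} w" for w :: real
  have [measurable]: "f \<in> borel_measurable borel" unfolding f_def by measurable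
  have nonneg: "ennreal (z powr p) = (\<integral>\<^sup>+w. ennreal (z - w) + ennreal (- z - w) \<partial>density lborel f)"
    if z: "0 \<le> z" for z
  proof -
    \<comment> \<open>Antiderivative of \<open>H'\<close>, found by integration by parts. Its
      boundary values give Taylor's formula at 0: \<open>z powr p\<close> is the integral of the
      second derivative against \<open>z - w\<close>.\<close>
    define H where "H w = p * w powr (p - 1) * z - (p - 1) * w powr p" for w
    define H' where "H' w = p * (p - 1) * w powr (p - 2) * (z - w)" for w
    \<comment> \<open>For \<open>p < 2\<close> the second derivative blows up at 0, so the
      derivative is taken only in the open interval, with \<open>H\<close> continuous up to the
      endpoints.\<close>
    have "(H' has_integral (H z - H 0)) {0..z}"
    proof (rule fundamental_theorem_of_calculus_interior[OF z])
      show "continuous_on {0..z} H"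
        unfolding H_def using p by (intro continuous_intros continuous_on_powr') auto
      fix w assume w: "w \<in> {0<..<z}"
      have "(H has_real_derivative
          p * ((p - 1) * w powr (p - 1 - 1)) * z - (p - 1) * (p * w powr (p - 1))) (at w)"
        unfolding H_def using w by (auto intro!: derivative_eq_intros)
      moreover have "w powr (p - 1) = w powr (p - 2) * w"
        using w powr_add[of w "p - 2" 1] by simp
      ultimately have "(H has_real_derivative H' w) (at w)"
        by (simp add: H'_def algebra_simps)
      then show "(H has_vector_derivative H' w) (at w)"
        by (simp add: has_real_derivative_iff_has_vector_derivative)
    qed
    moreover have "H z - H 0 = z powr p"
      using z p powr_add[of z "p - 1" 1] by (cases "z = 0") (auto simp: H_def algebra_simps)
    moreover have "0 \<le> H' w" if "w \<in> {0..z}" for w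
      using that p by (simp add: H'_def)
    ultimately have "(\<integral>\<^sup>+w. ennreal (H' w) * indicator {0..z} w \<partial>lborel) = ennreal (z powr p)"
      by (intro nn_integral_has_integral_lebesgue') auto
    moreover have "f w * (ennreal (z - w) + ennreal (- z - w)) = ennreal (H' w) * indicator {0..z} w" for w
      using z p by (auto simp: f_def H'_def indicator_def ennreal_neg simp flip: ennreal_mult')
    ultimately show ?thesis by (simp add: nn_integral_density)
  qed
  show ?thesis
  proof
    show "sigma_finite_measure (density lborel f)"
      by (subst sigma_finite_measure.sigma_finite_iff_density_finite'[OF lborel.sigma_finite_measure_axioms]) (auto simp: f_def indicator_def)
    show "ennreal (\<bar>z\<bar> powr p) = (\<integral>\<^sup>+w. ennreal (z - w) + ennreal (- z - w) \<partial>density lborel f)" for z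
      using nonneg[of z] nonneg[of "- z"] by (cases "0 \<le> z") (simp_all add: add.commute)
  qed simp
qed

text \<open>The positive part of \<open>A \<omega> - B \<omega> - w\<close> is the length of the
  interval of all \<open>s\<close> with \<open>B \<omega> + w \<le> s < A \<omega>\<close>, and
  Tonelli exchanges the integrals. The joint law then enters only through the probabilities of
  simple quadrant events.\<close>

lemma (in prob_space) nn_integral_excess:
  fixes A B :: "'a \<Rightarrow> real"
  assumes [measurable]: "A \<in> borel_measurable M" "B \<in> borel_measurable M"
  shows "(\<integral>\<^sup>+\<omega>. ennreal (A \<omega> - B \<omega> - w) \<partial>M)
    = (\<integral>\<^sup>+s. ennreal (prob {\<omega>\<in>space M. B \<omega> \<le> s - w \<and> \<not> A \<omega> \<le> s}) \<partial>lborel)"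
proof -
  interpret pair_sigma_finite M lborel ..
  have layer: "ennreal (x - y - w) = (\<integral>\<^sup>+s. of_bool (y \<le> s - w \<and> \<not> x \<le> s) \<partial>lborel)" for x y :: real
  proof -
    have "(\<integral>\<^sup>+s. of_bool (y \<le> s - w \<and> \<not> x \<le> s) \<partial>lborel) = (\<integral>\<^sup>+s. indicator {y + w..<x} s \<partial>lborel)"
      by (intro nn_integral_cong) (auto simp: indicator_def)
    also have "\<dots> = ennreal (x - y - w)"
      by (cases "y + w \<le> x") (auto simp: ennreal_neg algebra_simps)
    finally show ?thesis ..
  qed
  have "(\<integral>\<^sup>+\<omega>. ennreal (A \<omega> - B \<omega> - w) \<partial>M)
      = (\<integral>\<^sup>+\<omega>. (\<integral>\<^sup>+s. of_bool (B \<omega> \<le> s - w \<and> \<not> A \<omega> \<le> s) \<partial>lborel) \<partial>M)"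
    by (simp add: layer)
  also have "\<dots> = (\<integral>\<^sup>+s. (\<integral>\<^sup>+\<omega>. of_bool (B \<omega> \<le> s - w \<and> \<not> A \<omega> \<le> s) \<partial>M) \<partial>lborel)"
    by (rule Fubini'[symmetric]) (simp add: of_bool_def split_beta')
  also have "\<dots> = (\<integral>\<^sup>+s. emeasure M {\<omega>\<in>space M. B \<omega> \<le> s - w \<and> \<not> A \<omega> \<le> s} \<partial>lborel)"
  proof (rule nn_integral_cong)
    fix s
    have "(\<integral>\<^sup>+\<omega>. of_bool (B \<omega> \<le> s - w \<and> \<not> A \<omega> \<le> s) \<partial>M)
        = (\<integral>\<^sup>+\<omega>. indicator {\<omega>\<in>space M. B \<omega> \<le> s - w \<and> \<not> A \<omega> \<le> s} \<omega> \<partial>M)"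
      by (intro nn_integral_cong) (auto simp: indicator_def)
    also have "\<dots> = emeasure M {\<omega>\<in>space M. B \<omega> \<le> s - w \<and> \<not> A \<omega> \<le> s}"
      by (rule nn_integral_indicator) measurable
    finally show "(\<integral>\<^sup>+\<omega>. of_bool (B \<omega> \<le> s - w \<and> \<not> A \<omega> \<le> s) \<partial>M)
        = emeasure M {\<omega>\<in>space M. B \<omega> \<le> s - w \<and> \<not> A \<omega> \<le> s}" .
  qed
  finally show ?thesis by (simp add: emeasure_eq_measure)
qed

lemma comonotone_sym: "comonotone M A B \<Longrightarrow> comonotone M B A"
  unfolding comonotone_def by blast

text \<open>For fixed marginals this probability decreases as that of \<open>A \<le> s\<close> and
  \<open>B \<le> t\<close> together grows, and the latter is at most the probability of
  \<open>A \<le> s\<close>. A comonotone pair either attains this bound or makes the left side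
  0.\<close>

lemma (in prob_space) prob_diff_comonotone_le:
  fixes A B A' B' :: "'a \<Rightarrow> real"
  assumes [measurable]: "A \<in> borel_measurable M" "B \<in> borel_measurable M"
      "A' \<in> borel_measurable M" "B' \<in> borel_measurable M"
    and A': "dist_fun M A' = dist_fun M A" and B': "dist_fun M B' = dist_fun M B"
    and "comonotone M A' B'"
  shows "prob {\<omega>\<in>space M. B' \<omega> \<le> t \<and> \<not> A' \<omega> \<le> s} \<le> prob {\<omega>\<in>space M. B \<omega> \<le> t \<and> \<not> A \<omega> \<le> s}"
proof -
  have prob_diff: "prob {\<omega>\<in>space M. D \<omega> \<le> t \<and> \<not> C \<omega> \<le> s}
      = dist_fun M D t - prob {\<omega>\<in>space M. C \<omega> \<le> s \<and> D \<omega> \<le> t}"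
    if [measurable]: "C \<in> borel_measurable M" "D \<in> borel_measurable M" for C D :: "'a \<Rightarrow> real"
    unfolding dist_fun_def
    by (subst finite_measure_Diff[symmetric]) (auto intro!: arg_cong[where f=prob])
  consider "AE \<omega> in M. A' \<omega> \<le> s \<longrightarrow> B' \<omega> \<le> t" | "AE \<omega> in M. B' \<omega> \<le> t \<longrightarrow> A' \<omega> \<le> s"
    using assms(7) unfolding comonotone_def by blast
  then show ?thesis
  proof cases
    case 1
    have "prob {\<omega>\<in>space M. A \<omega> \<le> s \<and> B \<omega> \<le> t} \<le> dist_fun M A s"
      unfolding dist_fun_def by (rule finite_measure_mono) auto
    also have "\<dots> = prob {\<omega>\<in>space M. A' \<omega> \<le> s \<and> B' \<omega> \<le> t}"
      unfolding A'[symmetric] unfolding dist_fun_def by (rule finite_measure_eq_AE) (use 1 in auto)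
    finally show ?thesis by (simp add: prob_diff B')
  next
    case 2
    then have "prob {\<omega>\<in>space M. B' \<omega> \<le> t \<and> \<not> A' \<omega> \<le> s} = 0"
      by (subst prob_Collect_eq_0) auto
    then show ?thesis by simp
  qed
qed

text \<open>\<open>powr_layers\<close> and \<open>nn_integral_excess\<close> turn the cost into a
  mixture of probabilities, all of which the comonotone pair minimizes at once. The layers with
  \<open>A\<close> and \<open>B\<close> exchanged follow from the symmetry of
  comonotonicity.\<close>

lemma (in prob_space) nn_integral_comonotone_le:
  fixes A B A' B' :: "'a \<Rightarrow> real"
  assumes "1 \<le> p"
    and [measurable]: "A \<in> borel_measurable M" "B \<in> borel_measurable M"
      "A' \<in> borel_measurable M" "B' \<in> borel_measurable M"
    and A': "dist_fun M A' = dist_fun M A" and B': "dist_fun M B' = dist_fun M B"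
    and "comonotone M A' B'"
  shows "(\<integral>\<^sup>+\<omega>. ennreal (\<bar>A' \<omega> - B' \<omega>\<bar> powr p) \<partial>M) \<le> (\<integral>\<^sup>+\<omega>. ennreal (\<bar>A \<omega> - B \<omega>\<bar> powr p) \<partial>M)"
proof -
  obtain m where "sigma_finite_measure m" and m[measurable_cong]: "sets m = sets borel"
    and layers: "\<And>z. ennreal (\<bar>z\<bar> powr p) = (\<integral>\<^sup>+w. ennreal (z - w) + ennreal (- z - w) \<partial>m)"
    using powr_layers[OF \<open>1 \<le> p\<close>] by blast
  then interpret pair_sigma_finite M m
    by (simp add: pair_sigma_finite_def sigma_finite_measure_axioms)
  have cost: "(\<integral>\<^sup>+\<omega>. ennreal (\<bar>C \<omega> - D \<omega>\<bar> powr p) \<partial>M)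
      = (\<integral>\<^sup>+w. (\<integral>\<^sup>+\<omega>. ennreal (C \<omega> - D \<omega> - w) \<partial>M) + (\<integral>\<^sup>+\<omega>. ennreal (D \<omega> - C \<omega> - w) \<partial>M) \<partial>m)"
    if [measurable]: "C \<in> borel_measurable M" "D \<in> borel_measurable M" for C D
  proof -
    have "(\<integral>\<^sup>+\<omega>. ennreal (\<bar>C \<omega> - D \<omega>\<bar> powr p) \<partial>M)
        = (\<integral>\<^sup>+\<omega>. (\<integral>\<^sup>+w. ennreal (C \<omega> - D \<omega> - w) + ennreal (D \<omega> - C \<omega> - w) \<partial>m) \<partial>M)"
      unfolding layers by simp
    also have "\<dots> = (\<integral>\<^sup>+w. (\<integral>\<^sup>+\<omega>. ennreal (C \<omega> - D \<omega> - w) + ennreal (D \<omega> - C \<omega> - w) \<partial>M) \<partial>m)"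
      by (rule Fubini'[symmetric]) measurable
    also have "\<dots> = (\<integral>\<^sup>+w. (\<integral>\<^sup>+\<omega>. ennreal (C \<omega> - D \<omega> - w) \<partial>M) + (\<integral>\<^sup>+\<omega>. ennreal (D \<omega> - C \<omega> - w) \<partial>M) \<partial>m)"
      by (intro nn_integral_cong nn_integral_add) auto
    finally show ?thesis .
  qed
  show ?thesis
    unfolding cost[OF assms(2,3)] cost[OF assms(4,5)]
  proof (rule nn_integral_mono, rule add_mono)
    fix w
    show "(\<integral>\<^sup>+\<omega>. ennreal (A' \<omega> - B' \<omega> - w) \<partial>M) \<le> (\<integral>\<^sup>+\<omega>. ennreal (A \<omega> - B \<omega> - w) \<partial>M)"
      unfolding nn_integral_excess[OF assms(2,3)] nn_integral_excess[OF assms(4,5)]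
      by (intro nn_integral_mono ennreal_leI prob_diff_comonotone_le assms)
    show "(\<integral>\<^sup>+\<omega>. ennreal (B' \<omega> - A' \<omega> - w) \<partial>M) \<le> (\<integral>\<^sup>+\<omega>. ennreal (B \<omega> - A \<omega> - w) \<partial>M)"
      unfolding nn_integral_excess[OF assms(3,2)] nn_integral_excess[OF assms(5,4)]
      by (intro nn_integral_mono ennreal_leI prob_diff_comonotone_le assms comonotone_sym)
  qed
qed

section \<open>Norms and moments\<close>

lemma lnorm_nonneg: "0 \<le> lnorm a x"
  by (simp add: lnorm_def)

lemma lnorm_scaleR:
  assumes "1 \<le> a"
  shows "lnorm a (c *\<^sub>R x) = \<bar>c\<bar> * lnorm a x"
  using assms
  by (simp add: lnorm_def abs_mult powr_mult powr_powr sum_nonneg flip: sum_distrib_left)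

lemma component_le_lnorm:
  assumes "1 \<le> a"
  shows "\<bar>x $ i\<bar> \<le> lnorm a x"
proof -
  have "\<bar>x $ i\<bar> = (\<bar>x $ i\<bar> powr a) powr (1 / a)" using assms by (simp add: powr_powr)
  also have "\<dots> \<le> lnorm a x"
    unfolding lnorm_def using assms by (intro powr_mono2 member_le_sum) auto
  finally show ?thesis .
qed

lemma norm_le_lnorm:
  fixes x :: "real ^ 'n"
  assumes "1 \<le> a"
  shows "norm x \<le> CARD('n) * lnorm a x"
proof -
  have "norm x \<le> (\<Sum>i\<in>UNIV. \<bar>x $ i\<bar>)" by (rule norm_le_l1_cart)
  also have "\<dots> \<le> CARD('n) * lnorm a x"
    by (rule sum_bounded_above) (rule component_le_lnorm[OF assms])
  finally show ?thesis .
qed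

lemma lnorm_le_norm:
  fixes x :: "real ^ 'n"
  assumes "1 \<le> a"
  shows "lnorm a x \<le> CARD('n) powr (1 / a) * norm x"
proof -
  have "lnorm a x \<le> (CARD('n) * norm x powr a) powr (1 / a)"
    unfolding lnorm_def using assms
    by (intro powr_mono2 sum_bounded_above sum_nonneg) (auto intro!: powr_mono2 component_le_norm_cart)
  also have "\<dots> = CARD('n) powr (1 / a) * norm x"
    using assms by (simp add: powr_mult powr_powr)
  finally show ?thesis .
qed

lemma lnorm_eq_0_iff:
  assumes "1 \<le> a"
  shows "lnorm a x = 0 \<longleftrightarrow> x = 0"
  using norm_le_lnorm[OF assms, of x] assms by (auto simp: lnorm_def)

lemma continuous_on_lnorm:
  assumes "1 \<le> a"
  shows "continuous_on S (lnorm a)"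
  unfolding lnorm_def[abs_def] using assms
  by (intro continuous_on_powr' continuous_intros) (auto intro!: sum_nonneg)

lemma borel_measurable_lnorm: "1 \<le> a \<Longrightarrow> lnorm a \<in> borel_measurable borel"
  by (intro borel_measurable_continuous_onI continuous_on_lnorm)

section \<open>Closure properties of the moment classes\<close>

lemma Lp_vars_dominated:
  fixes X :: "'w \<Rightarrow> 'a::ordered_euclidean_space" and Y :: "'w \<Rightarrow> 'b::ordered_euclidean_space"
  assumes "X \<in> Lp_vars P p N" "Y \<in> borel_measurable P" "N' \<in> borel_measurable borel"
    and "0 \<le> p" "0 \<le> C"
    and bound: "\<And>\<omega>. 0 \<le> N (X \<omega>)" "\<And>\<omega>. 0 \<le> N' (Y \<omega>)" "\<And>\<omega>. N' (Y \<omega>) \<le> C * N (X \<omega>)"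
  shows "Y \<in> Lp_vars P p N'"
proof -
  note [measurable] = assms(2,3)
  have "integrable P (\<lambda>\<omega>. C powr p * N (X \<omega>) powr p)"
    using assms(1) by (simp add: Lp_vars_def)
  then have "integrable P (\<lambda>\<omega>. N' (Y \<omega>) powr p)"
  proof (rule Bochner_Integration.integrable_bound)
    show "AE \<omega> in P. norm (N' (Y \<omega>) powr p) \<le> norm (C powr p * N (X \<omega>) powr p)"
      using assms by (auto intro!: AE_I2 powr_mono2 simp flip: powr_mult)
  qed measurable
  then show ?thesis by (simp add: Lp_vars_def)
qed

text \<open>Equivalence of norms moves moment questions to the Euclidean norm, whose triangle
  inequality gives closure under sums. Minkowski's inequality for \<open>lnorm a\<close> is thereby
  avoided.\<close>

lemma Lp_vars_lnorm:
  fixes P :: "'w measure"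
  assumes "1 \<le> a" "0 \<le> p"
  shows "Lp_vars P p (lnorm a :: real ^ 'n \<Rightarrow> real) = Lp_vars P p norm"
proof (intro equalityI subsetI)
  fix X :: "'w \<Rightarrow> real ^ 'n"
  show "X \<in> Lp_vars P p norm" if "X \<in> Lp_vars P p (lnorm a)"
    by (rule Lp_vars_dominated[OF that, of _ _ "CARD('n)"])
      (use that assms in \<open>auto simp: Lp_vars_def lnorm_nonneg norm_le_lnorm\<close>)
  show "X \<in> Lp_vars P p (lnorm a)" if "X \<in> Lp_vars P p norm"
    by (rule Lp_vars_dominated[OF that, of _ _ "CARD('n) powr (1 / a)"])
      (use that assms in \<open>auto simp: Lp_vars_def lnorm_nonneg lnorm_le_norm borel_measurable_lnorm\<close>)
qed

lemma Lp_vars_add: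
  fixes X Y :: "'w \<Rightarrow> 'a::ordered_euclidean_space"
  assumes X: "X \<in> Lp_vars P p norm" and Y: "Y \<in> Lp_vars P p norm" and "0 \<le> p"
  shows "(\<lambda>\<omega>. X \<omega> + Y \<omega>) \<in> Lp_vars P p norm"
proof -
  have [measurable]: "X \<in> borel_measurable P" "Y \<in> borel_measurable P"
    using X Y by (auto simp: Lp_vars_def)
  have "integrable P (\<lambda>\<omega>. 2 powr p * (norm (X \<omega>) powr p + norm (Y \<omega>) powr p))"
    using X Y by (simp add: Lp_vars_def)
  then have "integrable P (\<lambda>\<omega>. norm (X \<omega> + Y \<omega>) powr p)"
  proof (rule Bochner_Integration.integrable_bound)
    have "norm (x + y) powr p \<le> 2 powr p * (norm x powr p + norm y powr p)" for x y :: 'a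
    proof -
      have "norm (x + y) \<le> 2 * max (norm x) (norm y)"
        using norm_triangle_ineq[of x y] by linarith
      then have "norm (x + y) powr p \<le> 2 powr p * max (norm x) (norm y) powr p"
        using \<open>0 \<le> p\<close> by (auto intro!: powr_mono2 simp flip: powr_mult)
      also have "max (norm x) (norm y) powr p \<le> norm x powr p + norm y powr p"
        by (simp add: max_def)
      finally show ?thesis by simp
    qed
    then show "AE \<omega> in P. norm (norm (X \<omega> + Y \<omega>) powr p)
        \<le> norm (2 powr p * (norm (X \<omega>) powr p + norm (Y \<omega>) powr p))"
      by (intro AE_I2) (simp add: abs_mult)
  qed measurable
  then show ?thesis by (simp add: Lp_vars_def)
qed

lemma Lp_vars_diff:
  fixes X Y :: "'w \<Rightarrow> 'a::ordered_euclidean_space"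
  assumes "X \<in> Lp_vars P p norm" "Y \<in> Lp_vars P p norm" "0 \<le> p"
  shows "(\<lambda>\<omega>. X \<omega> - Y \<omega>) \<in> Lp_vars P p norm"
proof -
  have "(\<lambda>\<omega>. - Y \<omega>) \<in> Lp_vars P p norm" using assms(2) by (simp add: Lp_vars_def)
  from Lp_vars_add[OF assms(1) this assms(3)] show ?thesis by simp
qed

lemma Lp_vars_distr_cong:
  fixes X Y :: "'w \<Rightarrow> 'a::ordered_euclidean_space"
  assumes [measurable]: "Y \<in> borel_measurable P" "N \<in> borel_measurable borel"
    and X: "X \<in> Lp_vars P p N" and eq: "distr P borel X = distr P borel Y"
  shows "Y \<in> Lp_vars P p N"
proof -
  have [measurable]: "X \<in> borel_measurable P" using X by (simp add: Lp_vars_def)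
  have "integrable (distr P borel X) (\<lambda>x. N x powr p)"
    using X by (subst integrable_distr_eq) (auto simp: Lp_vars_def)
  then have "integrable P (\<lambda>\<omega>. N (Y \<omega>) powr p)"
    unfolding eq by (subst (asm) integrable_distr_eq) auto
  then show ?thesis by (simp add: Lp_vars_def)
qed

section \<open>Bounds on the Wasserstein distance\<close>

lemma wasserstein_le:
  assumes "X \<in> borel_measurable P" "Y \<in> borel_measurable P" "dist_fun P X = F" "dist_fun P Y = G"
  shows "wasserstein P p N F G \<le> (\<integral>\<omega>. N (X \<omega> - Y \<omega>) powr p \<partial>P) powr (1 / p)"
  unfolding wasserstein_def using assms by (intro cInf_lower bdd_belowI[of _ 0]) auto

text \<open>\<open>X\<close> and \<open>Y\<close> themselves form a coupling, so the infimum is over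
  a nonempty set.\<close>

lemma le_wasserstein:
  assumes "X \<in> borel_measurable P" "Y \<in> borel_measurable P"
    and "\<And>A B. A \<in> borel_measurable P \<Longrightarrow> B \<in> borel_measurable P \<Longrightarrow>
      dist_fun P A = dist_fun P X \<Longrightarrow> dist_fun P B = dist_fun P Y \<Longrightarrow>
      c \<le> (\<integral>\<omega>. N (A \<omega> - B \<omega>) powr p \<partial>P) powr (1 / p)"
  shows "c \<le> wasserstein P p N (dist_fun P X) (dist_fun P Y)"
  unfolding wasserstein_def using assms by (intro cInf_greatest) auto

text \<open>For linear \<open>g\<close>, the functional attains its maximum on the compact unit
  ball, and this maximum is the least Lipschitz constant. Otherwise \<open>K\<close> equals
  \<open>infnorm \<beta>\<close>, and the signed axis at a largest entry of \<open>\<beta>\<close>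
  is a direction along which the \<open>h\<close> part stays constant.\<close>

lemma steepest_direction:
  fixes g h :: "real ^ 'n \<Rightarrow> real"
  assumes a: "1 \<le> a" and K: "is_lipschitz_constant (lnorm a) UNIV g K" "0 < K"
    and dec: "decomposition g I h \<beta>"
    and L: "is_lipschitz_constant (lnorm a) (coord_space I) h L"
    and cases: "(a = 1 \<and> infnorm \<beta> \<ge> L) \<or> card I = 0"
  obtains v where "lnorm a v \<le> 1" "\<And>x t. g (x + t *\<^sub>R v) = g x + t * K"
proof -
  have lip: "\<bar>g x - g y\<bar> \<le> K * lnorm a (x - y)" for x y
    using K(1) by (simp add: is_lipschitz_constant_def lipschitz_bound_def)
  have least: "K \<le> C" if "0 \<le> C" "\<And>x y. \<bar>g x - g y\<bar> \<le> C * lnorm a (x - y)" for C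
    using K(1) that by (simp add: is_lipschitz_constant_def lipschitz_bound_def)
  have \<beta>I: "\<beta> $ i = 0" if "i \<in> I" for i
    using dec that by (simp add: decomposition_def coord_space_def)
  have g: "g x = h (coord_part I x) + \<beta> \<bullet> x" for x
  proof -
    have "\<beta> \<bullet> coord_part (- I) x = \<beta> \<bullet> x"
      unfolding inner_vec_def by (rule sum.cong) (auto simp: coord_part_def \<beta>I)
    then show ?thesis using dec by (simp add: decomposition_def)
  qed
  show ?thesis
  proof (cases "card I = 0")
    case True
    then have "I = {}" by simp
    then have lin: "g x = \<beta> \<bullet> x" for x
      using dec by (simp add: g decomposition_def coord_part_def zero_vec_def[symmetric])
    let ?B = "{v :: real ^ 'n. lnorm a v \<le> 1}"
    have "compact ?B"
      unfolding compact_eq_bounded_closed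
    proof
      have "norm v \<le> CARD('n)" if "v \<in> ?B" for v
        using order_trans[OF norm_le_lnorm[OF a, of v], of "CARD('n)"] that
          mult_left_le[of "lnorm a v" "CARD('n)"] by simp
      then show "bounded ?B" by (rule boundedI)
      show "closed ?B"
        by (intro closed_Collect_le continuous_on_lnorm continuous_on_const a)
    qed
    moreover have zero: "0 \<in> ?B" using lnorm_eq_0_iff[OF a, of "0 :: real ^ 'n"] by simp
    ultimately obtain v where v: "v \<in> ?B" "\<And>w. w \<in> ?B \<Longrightarrow> \<beta> \<bullet> w \<le> \<beta> \<bullet> v"
      using continuous_attains_sup[of ?B "\<lambda>w. \<beta> \<bullet> w", OF _ _ continuous_on_inner[OF continuous_on_const continuous_on_id]]
      by blast
    have upper: "\<beta> \<bullet> x \<le> \<beta> \<bullet> v * lnorm a x" for x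
    proof (cases "x = 0")
      case False
      then have pos: "0 < lnorm a x"
        using lnorm_eq_0_iff[OF a, of x] lnorm_nonneg[of a x] by simp
      then have "\<beta> \<bullet> (inverse (lnorm a x) *\<^sub>R x) \<le> \<beta> \<bullet> v"
        by (intro v(2)) (simp add: lnorm_scaleR[OF a])
      then show ?thesis using pos by (simp add: field_simps)
    qed (simp add: lnorm_eq_0_iff[OF a, of 0, simplified])
    \<comment> \<open>Applied to \<open>x - y\<close> and its negative, \<open>upper\<close> makes
      the maximum a Lipschitz bound, and \<open>K\<close> is the least one.\<close>
    have "K \<le> \<beta> \<bullet> v"
    proof (rule least)
      show "0 \<le> \<beta> \<bullet> v" using v(2)[OF zero] by simp
      show "\<bar>g x - g y\<bar> \<le> \<beta> \<bullet> v * lnorm a (x - y)" for x y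
        using upper[of "x - y"] upper[of "- (x - y)"] lnorm_scaleR[OF a, of "-1" "x - y"]
        by (simp add: lin inner_diff_right)
    qed
    moreover have "\<beta> \<bullet> v \<le> K"
    proof -
      have "\<beta> \<bullet> v \<le> K * lnorm a v" using lip[of v 0] by (simp add: lin)
      also have "\<dots> \<le> K" using v(1) K(2) by (simp add: mult_left_le)
      finally show ?thesis .
    qed
    ultimately show ?thesis
      using v(1) by (intro that[of v]) (auto simp: lin inner_add_right)
  next
    case False
    with cases have a1: "a = 1" and \<beta>L: "L \<le> infnorm \<beta>" by auto
    have l1: "lnorm a x = (\<Sum>i\<in>UNIV. \<bar>x $ i\<bar>)" for x :: "real ^ 'n"
      by (simp add: lnorm_def a1 sum_nonneg)
    have hL: "\<bar>h x - h y\<bar> \<le> L * lnorm a (x - y)" if "x \<in> coord_space I" "y \<in> coord_space I" for x y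
      using L that by (simp add: is_lipschitz_constant_def lipschitz_bound_def)
    \<comment> \<open>The l1 norm is the sum of its parts on \<open>I\<close> and off
      \<open>I\<close>. The first part is handled by \<open>L \<le> infnorm \<beta>\<close>, the
      second by the size of the entries of \<open>\<beta>\<close>, so a single constant serves
      both.\<close>
    have "K \<le> infnorm \<beta>"
    proof (rule least)
      fix x y
      have "\<bar>h (coord_part I x) - h (coord_part I y)\<bar> \<le> L * lnorm a (coord_part I x - coord_part I y)"
        by (rule hL) (auto simp: coord_space_def coord_part_def)
      also have "\<dots> \<le> infnorm \<beta> * lnorm a (coord_part I x - coord_part I y)"
        by (intro mult_right_mono \<beta>L lnorm_nonneg)
      also have "\<dots> = (\<Sum>i\<in>UNIV. infnorm \<beta> * (if i \<in> I then \<bar>x $ i - y $ i\<bar> else 0))"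
        unfolding l1 sum_distrib_left by (rule sum.cong) (auto simp: coord_part_def)
      finally have *: "\<bar>h (coord_part I x) - h (coord_part I y)\<bar> \<le> \<dots>" .
      have "\<bar>\<beta> \<bullet> (x - y)\<bar> \<le> (\<Sum>i\<in>UNIV. \<bar>\<beta> $ i * (x $ i - y $ i)\<bar>)"
        unfolding inner_vec_def by (rule order_trans[OF sum_abs]) simp
      also have "\<dots> \<le> (\<Sum>i\<in>UNIV. infnorm \<beta> * (if i \<in> I then 0 else \<bar>x $ i - y $ i\<bar>))"
        by (rule sum_mono) (auto simp: \<beta>I abs_mult intro!: mult_right_mono component_le_infnorm_cart)
      finally have "\<bar>g x - g y\<bar> \<le> (\<Sum>i\<in>UNIV. infnorm \<beta> * (if i \<in> I then \<bar>x $ i - y $ i\<bar> else 0))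
          + (\<Sum>i\<in>UNIV. infnorm \<beta> * (if i \<in> I then 0 else \<bar>x $ i - y $ i\<bar>))"
        using * unfolding g inner_diff_right by linarith
      also have "\<dots> = infnorm \<beta> * lnorm a (x - y)"
        unfolding l1 sum_distrib_left sum.distrib[symmetric] by (rule sum.cong) auto
      finally show "\<bar>g x - g y\<bar> \<le> infnorm \<beta> * lnorm a (x - y)" .
    qed (rule infnorm_pos_le)
    have "infnorm \<beta> \<in> (\<lambda>b. \<bar>\<beta> \<bullet> b\<bar>) ` Basis"
      unfolding infnorm_Max by (rule Max_in) auto
    then obtain i where i: "infnorm \<beta> = \<bar>\<beta> $ i\<bar>"
      by (auto simp: Basis_vec_def inner_axis)
    \<comment> \<open>\<open>\<beta>\<close> vanishes on \<open>I\<close>, whereas its largest entry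
      has size at least \<open>K > 0\<close>. Moving along axis \<open>i\<close> therefore leaves
      the argument of \<open>h\<close> fixed.\<close>
    have "i \<notin> I" using \<open>K \<le> infnorm \<beta>\<close> K(2) \<beta>I[of i] i by auto
    define v :: "real ^ 'n" where "v = axis i (sgn (\<beta> $ i))"
    have line: "g (x + t *\<^sub>R v) = g x + t * \<bar>\<beta> $ i\<bar>" for x t
    proof -
      have "coord_part I (x + t *\<^sub>R v) = coord_part I x"
        using \<open>i \<notin> I\<close> by (auto simp: coord_part_def v_def axis_def vec_eq_iff)
      then show ?thesis
        by (simp add: g inner_add_right v_def inner_axis abs_sgn)
    qed
    have v: "lnorm a v \<le> 1"
      unfolding l1 v_def axis_def by (simp add: if_distrib[where f=abs] abs_sgn_eq cong: if_cong)
    \<comment> \<open>The reverse inequality: the slope along a vector of length at most 1 cannot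
      exceed \<open>K\<close>.\<close>
    have "\<bar>\<beta> $ i\<bar> \<le> K * lnorm a v"
      using lip[of "0 + 1 *\<^sub>R v" 0] line[of 0 1] by simp
    also have "\<dots> \<le> K" using v K(2) by (simp add: mult_left_le)
    finally show ?thesis
      using that[OF v] line \<open>K \<le> infnorm \<beta>\<close> i by simp
  qed
qed

section \<open>Optimal couplings and uncertainty sets\<close>

text \<open>Every coupling of \<open>Z\<close> and \<open>X\<close>, pushed through
  \<open>g\<close>, couples the images at a cost larger by a factor of at most
  \<open>K\<close>.\<close>

lemma wasserstein_lipschitz_image:
  fixes g :: "real ^ 'n \<Rightarrow> real" and P :: "'w measure"
  assumes "prob_space P" and [measurable]: "g \<in> borel_measurable borel"
    and "1 \<le> a" "1 \<le> p" "0 < K"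
    and lip: "\<And>x y. \<bar>g x - g y\<bar> \<le> K * lnorm a (x - y)"
    and X: "X \<in> Lp_vars P p (lnorm a)" and Z: "Z \<in> Lp_vars P p (lnorm a)"
  shows "wasserstein P p abs (dist_fun P (g \<circ> Z)) (dist_fun P (g \<circ> X))
    \<le> K * wasserstein P p (lnorm a) (dist_fun P Z) (dist_fun P X)"
proof -
  let ?W = "wasserstein P p abs (dist_fun P (g \<circ> Z)) (dist_fun P (g \<circ> X))"
  have lnorm_meas: "lnorm a \<in> borel_measurable borel"
    by (rule borel_measurable_lnorm) fact
  have "?W / K \<le> wasserstein P p (lnorm a) (dist_fun P Z) (dist_fun P X)"
  proof (rule le_wasserstein)
    fix A B :: "'w \<Rightarrow> real ^ 'n"
    assume AB[measurable]: "A \<in> borel_measurable P" "B \<in> borel_measurable P"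
      and dist: "dist_fun P A = dist_fun P Z" "dist_fun P B = dist_fun P X"
    have [measurable]: "Z \<in> borel_measurable P" "X \<in> borel_measurable P"
      using X Z by (auto simp: Lp_vars_def)
    \<comment> \<open>Couplings are specified by distribution functions, which cannot be pushed
      through \<open>g\<close> directly, whereas laws can.\<close>
    have dA: "distr P borel Z = distr P borel A" and dB: "distr P borel X = distr P borel B"
      by (rule distr_eqI_dist_fun, fact, fact, simp, simp, simp add: dist)+
    have "A \<in> Lp_vars P p norm" "B \<in> Lp_vars P p norm"
      using Lp_vars_distr_cong[OF AB(1) lnorm_meas Z dA] Lp_vars_distr_cong[OF AB(2) lnorm_meas X dB]
        \<open>1 \<le> a\<close> \<open>1 \<le> p\<close> by (simp_all add: Lp_vars_lnorm)
    then have "(\<lambda>\<omega>. A \<omega> - B \<omega>) \<in> Lp_vars P p (lnorm a)"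
      using \<open>1 \<le> a\<close> \<open>1 \<le> p\<close> by (simp add: Lp_vars_lnorm Lp_vars_diff)
    \<comment> \<open>The majorant must be integrable: otherwise its Bochner integral would be 0 and
      monotonicity would fail.\<close>
    then have int: "integrable P (\<lambda>\<omega>. lnorm a (A \<omega> - B \<omega>) powr p)"
      by (simp add: Lp_vars_def)
    have distr_comp: "distr P borel (g \<circ> C) = distr (distr P borel C) borel g"
      if [measurable]: "C \<in> borel_measurable P" for C :: "'w \<Rightarrow> real ^ 'n"
      by (simp add: distr_distr)
    have "?W \<le> (\<integral>\<omega>. \<bar>(g \<circ> A) \<omega> - (g \<circ> B) \<omega>\<bar> powr p \<partial>P) powr (1 / p)"
      by (intro wasserstein_le[of "g \<circ> A" P "g \<circ> B"] dist_fun_eqI_distr) (simp_all add: distr_comp dA dB)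
    also have "\<dots> \<le> (\<integral>\<omega>. K powr p * lnorm a (A \<omega> - B \<omega>) powr p \<partial>P) powr (1 / p)"
    proof (intro powr_mono2 integral_mono_AE' AE_I2)
      show "integrable P (\<lambda>\<omega>. K powr p * lnorm a (A \<omega> - B \<omega>) powr p)" using int by simp
      show "\<bar>(g \<circ> A) \<omega> - (g \<circ> B) \<omega>\<bar> powr p \<le> K powr p * lnorm a (A \<omega> - B \<omega>) powr p" for \<omega>
        using lip[of "A \<omega>" "B \<omega>"] \<open>0 < K\<close> \<open>1 \<le> p\<close>
        by (auto intro!: powr_mono2 simp: lnorm_nonneg simp flip: powr_mult)
    qed (use \<open>1 \<le> p\<close> in auto)
    also have "\<dots> = K * (\<integral>\<omega>. lnorm a (A \<omega> - B \<omega>) powr p \<partial>P) powr (1 / p)"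
      using \<open>0 < K\<close> \<open>1 \<le> p\<close> by (simp add: powr_mult powr_powr)
    finally show "?W / K \<le> (\<integral>\<omega>. lnorm a (A \<omega> - B \<omega>) powr p \<partial>P) powr (1 / p)"
      using \<open>0 < K\<close> by (simp add: field_simps)
  qed (use X Z in \<open>auto simp: Lp_vars_def\<close>)
  then show ?thesis using \<open>0 < K\<close> by (simp add: field_simps)
qed

text \<open>The comonotone pair beats every pair with the laws of \<open>Y\<close> and
  \<open>g \<circ> X\<close>, including those whose second entry does not come from a copy of
  \<open>X\<close>. So the infimum is attained by a pair of the form needed to build
  \<open>Z\<close>.\<close>

lemma optimal_coupling:
  fixes P :: "'b::euclidean_space measure" and X :: "'b \<Rightarrow> 'a::ordered_euclidean_space"
    and Y :: "'b \<Rightarrow> real" and g :: "'a \<Rightarrow> real"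
  assumes P: "prob_space P" "sets P = sets borel" "nonatomic P" and "1 \<le> p"
    and X[measurable]: "X \<in> borel_measurable P" and g[measurable]: "g \<in> borel_measurable borel"
    and gX: "g \<circ> X \<in> Lp_vars P p norm" and Y: "Y \<in> Lp_vars P p norm"
  obtains X' Y' where "X' \<in> borel_measurable P" "Y' \<in> borel_measurable P"
    "distr P borel X' = distr P borel X" "distr P borel Y' = distr P borel Y"
    "(\<integral>\<omega>. \<bar>Y' \<omega> - g (X' \<omega>)\<bar> powr p \<partial>P) powr (1 / p)
      \<le> wasserstein P p abs (dist_fun P Y) (dist_fun P (g \<circ> X))"
proof -
  interpret prob_space P by fact
  have Y_meas[measurable]: "Y \<in> borel_measurable P" using Y by (simp add: Lp_vars_def)
  obtain X' Y' where X'[measurable]: "X' \<in> borel_measurable P" and Y'[measurable]: "Y' \<in> borel_measurable P"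
    and dX': "distr P borel X' = distr P borel X" and dY': "distr P borel Y' = distr P borel Y"
    and com: "comonotone P Y' (\<lambda>\<omega>. g (X' \<omega>))"
    using comonotone_coupling[OF P X Y_meas g] by blast
  have [measurable]: "g \<circ> X' \<in> borel_measurable P" "g \<circ> X \<in> borel_measurable P"
    using measurable_comp[OF X' g] measurable_comp[OF X g] by auto
  have "distr P borel (g \<circ> X') = distr (distr P borel X') borel g"
    by (simp add: distr_distr)
  also have "\<dots> = distr P borel (g \<circ> X)" by (simp add: dX' distr_distr)
  finally have dgX': "distr P borel (g \<circ> X') = distr P borel (g \<circ> X)" .
  \<comment> \<open>Finite moments make the cost of every coupling integrable, which carries the
    comparison of nonnegative integrals over to Bochner integrals.\<close>
  have integrable_cost: "integrable P (\<lambda>\<omega>. \<bar>A \<omega> - B \<omega>\<bar> powr p)"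
    if [measurable]: "A \<in> borel_measurable P" "B \<in> borel_measurable P"
      and "distr P borel A = distr P borel Y" "distr P borel B = distr P borel (g \<circ> X)" for A B
  proof -
    have "A \<in> Lp_vars P p norm" "B \<in> Lp_vars P p norm"
      using Lp_vars_distr_cong[OF _ _ Y] Lp_vars_distr_cong[OF _ _ gX] that by auto
    then have "(\<lambda>\<omega>. A \<omega> - B \<omega>) \<in> Lp_vars P p norm" using \<open>1 \<le> p\<close> by (simp add: Lp_vars_diff)
    then show ?thesis by (simp add: Lp_vars_def)
  qed
  have "(\<integral>\<omega>. \<bar>Y' \<omega> - (g \<circ> X') \<omega>\<bar> powr p \<partial>P) powr (1 / p)
      \<le> wasserstein P p abs (dist_fun P Y) (dist_fun P (g \<circ> X))"
  proof (rule le_wasserstein)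
    fix A B :: "'b \<Rightarrow> real"
    assume [measurable]: "A \<in> borel_measurable P" "B \<in> borel_measurable P"
      and dist: "dist_fun P A = dist_fun P Y" "dist_fun P B = dist_fun P (g \<circ> X)"
    have dAB: "distr P borel A = distr P borel Y" "distr P borel B = distr P borel (g \<circ> X)"
      by (rule distr_eqI_dist_fun, fact, fact, simp, simp, simp add: dist)+
    have "(\<integral>\<^sup>+\<omega>. ennreal (\<bar>Y' \<omega> - (g \<circ> X') \<omega>\<bar> powr p) \<partial>P) \<le> (\<integral>\<^sup>+\<omega>. ennreal (\<bar>A \<omega> - B \<omega>\<bar> powr p) \<partial>P)"
    proof (rule nn_integral_comonotone_le[OF \<open>1 \<le> p\<close>])
      show "dist_fun P Y' = dist_fun P A" "dist_fun P (g \<circ> X') = dist_fun P B"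
        unfolding dist using dY' dgX' by (auto intro: dist_fun_eqI_distr)
      show "comonotone P Y' (g \<circ> X')" using com by (simp add: comp_def)
    qed simp_all
    then have "(\<integral>\<omega>. \<bar>Y' \<omega> - (g \<circ> X') \<omega>\<bar> powr p \<partial>P) \<le> (\<integral>\<omega>. \<bar>A \<omega> - B \<omega>\<bar> powr p \<partial>P)"
      using integrable_cost[of Y' "g \<circ> X'"] integrable_cost[of A B] dAB dY' dgX'
      by (simp add: nn_integral_eq_integral)
    then show "(\<integral>\<omega>. \<bar>Y' \<omega> - (g \<circ> X') \<omega>\<bar> powr p \<partial>P) powr (1 / p)
        \<le> (\<integral>\<omega>. \<bar>A \<omega> - B \<omega>\<bar> powr p \<partial>P) powr (1 / p)"
      using \<open>1 \<le> p\<close> by (intro powr_mono2) auto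
  qed simp_all
  then show ?thesis using that[OF X' Y' dX' dY'] by (simp add: comp_def)
qed

theorem corollary1:
  fixes P :: "(real ^ 'n) measure"
    and p a K L \<epsilon> :: real
    and b :: ennreal
    and g h :: "real ^ 'n \<Rightarrow> real"
    and I :: "'n set"
    and \<beta> :: "real ^ 'n"
    and X :: "real ^ 'n \<Rightarrow> real ^ 'n"
  assumes "prob_space P"
    and "sets P = sets borel"
    and "nonatomic P"
    and "p \<ge> 1"
    and "a \<ge> 1"
    and "1 / ennreal a + 1 / b = 1"
    and "\<exists>x y. g x \<noteq> g y"
    and "is_lipschitz_constant (lnorm a) UNIV g K"
    and "minimal_decomposition g I h \<beta>"
    and "is_lipschitz_constant (lnorm a) (coord_space I) h L"
    and "X \<in> Lp_vars P p (lnorm a)"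
    and "g \<circ> X \<in> Lp_vars P p abs"
    and "\<epsilon> \<ge> 0"
    and "(a = 1 \<and> infnorm \<beta> \<ge> L) \<or> card I = 0"
  shows "law_closure P ((\<lambda>Z. g \<circ> Z) ` uncertainty_set P p (lnorm a) \<epsilon> X)
         = uncertainty_set P p abs (K * \<epsilon>) (g \<circ> X)"
proof -
  note p = \<open>p \<ge> 1\<close> and a = \<open>a \<ge> 1\<close>
  have abs_norm: "(abs :: real \<Rightarrow> real) = norm" by auto
  have lip: "\<bar>g x - g y\<bar> \<le> K * lnorm a (x - y)" for x y
    using assms(8) by (simp add: is_lipschitz_constant_def lipschitz_bound_def)
  have "0 \<le> K" using assms(8) by (simp add: is_lipschitz_constant_def lipschitz_bound_def)
  \<comment> \<open>With \<open>K = 0\<close> the function \<open>g\<close> would be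
    constant.\<close>
  moreover have "K \<noteq> 0" using assms(7) lip by fastforce
  ultimately have K: "0 < K" by simp
  obtain v where v: "lnorm a v \<le> 1" "\<And>x t. g (x + t *\<^sub>R v) = g x + t * K"
    using steepest_direction[OF a assms(8) K _ assms(10,14)] assms(9)
    unfolding minimal_decomposition_def by blast
  have "continuous_on UNIV g"
  proof (rule lipschitz_on_continuous_on)
    show "(K * CARD('n) powr (1 / a))-lipschitz_on UNIV g"
    proof (rule lipschitz_onI)
      fix x y
      show "dist (g x) (g y) \<le> K * CARD('n) powr (1 / a) * dist x y"
        using order_trans[OF lip mult_left_mono[OF lnorm_le_norm[OF a, of "x - y"] \<open>0 \<le> K\<close>]]
        by (simp add: dist_norm mult.assoc)
    qed (use \<open>0 \<le> K\<close> in simp)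
  qed
  then have g[measurable]: "g \<in> borel_measurable borel" by (rule borel_measurable_continuous_onI)
  have X[measurable]: "X \<in> borel_measurable P" using assms(11) by (simp add: Lp_vars_def)
  have distr_comp: "distr P borel (g \<circ> C) = distr (distr P borel C) borel g"
    if [measurable]: "C \<in> borel_measurable P" for C :: "real ^ 'n \<Rightarrow> real ^ 'n"
    by (simp add: distr_distr)
  have X_norm: "X \<in> Lp_vars P p norm" and gX_norm: "g \<circ> X \<in> Lp_vars P p norm"
    using assms(11,12) a p by (simp_all add: Lp_vars_lnorm abs_norm)
  show ?thesis
  proof (intro equalityI subsetI)
    fix Y assume "Y \<in> law_closure P ((\<lambda>Z. g \<circ> Z) ` uncertainty_set P p (lnorm a) \<epsilon> X)"
    then obtain Z where Y[measurable]: "Y \<in> borel_measurable P"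
      and YZ: "dist_fun P Y = dist_fun P (g \<circ> Z)"
      and Z: "Z \<in> Lp_vars P p (lnorm a)"
      and W: "wasserstein P p (lnorm a) (dist_fun P Z) (dist_fun P X) \<le> \<epsilon>"
      by (auto simp: law_closure_def uncertainty_set_def)
    have [measurable]: "Z \<in> borel_measurable P" using Z by (simp add: Lp_vars_def)
    have gZ: "g \<circ> Z \<in> borel_measurable P" using measurable_comp[of Z P borel g] by simp
    \<comment> \<open>The moment of \<open>g \<circ> Z\<close> is obtained from that of
      \<open>g \<circ> X\<close>, since their difference is dominated by \<open>K\<close> times the
      length of \<open>Z - X\<close>.\<close>
    have "(\<lambda>\<omega>. Z \<omega> - X \<omega>) \<in> Lp_vars P p (lnorm a)"
      using Z assms(11) a p by (simp add: Lp_vars_lnorm Lp_vars_diff)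
    then have "(\<lambda>\<omega>. g (Z \<omega>) - g (X \<omega>)) \<in> Lp_vars P p norm"
      by (rule Lp_vars_dominated) (use p \<open>0 \<le> K\<close> lip in \<open>auto simp: lnorm_nonneg\<close>)
    from Lp_vars_add[OF this gX_norm]
    have "g \<circ> Z \<in> Lp_vars P p norm"
      using p by (simp add: comp_def)
    from Lp_vars_distr_cong[OF Y _ this distr_eqI_dist_fun[OF assms(1,1) gZ Y YZ[symmetric]]]
    have "Y \<in> Lp_vars P p abs" unfolding abs_norm by simp
    moreover have "wasserstein P p abs (dist_fun P Y) (dist_fun P (g \<circ> X)) \<le> K * \<epsilon>"
      unfolding YZ
      using wasserstein_lipschitz_image[OF assms(1) g a p K lip assms(11) Z] mult_left_mono[OF W \<open>0 \<le> K\<close>]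
      by (rule order_trans)
    ultimately show "Y \<in> uncertainty_set P p abs (K * \<epsilon>) (g \<circ> X)"
      by (simp add: uncertainty_set_def)
  next
    fix Y assume "Y \<in> uncertainty_set P p abs (K * \<epsilon>) (g \<circ> X)"
    then have Y: "Y \<in> Lp_vars P p norm"
      and W: "wasserstein P p abs (dist_fun P Y) (dist_fun P (g \<circ> X)) \<le> K * \<epsilon>"
      by (simp_all add: uncertainty_set_def abs_norm)
    have Y_meas[measurable]: "Y \<in> borel_measurable P" using Y by (simp add: Lp_vars_def)
    obtain X' Y' where X'[measurable]: "X' \<in> borel_measurable P" and Y'[measurable]: "Y' \<in> borel_measurable P"
      and dX': "distr P borel X' = distr P borel X" and dY': "distr P borel Y' = distr P borel Y"
      and cost: "(\<integral>\<omega>. \<bar>Y' \<omega> - g (X' \<omega>)\<bar> powr p \<partial>P) powr (1 / p)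
        \<le> wasserstein P p abs (dist_fun P Y) (dist_fun P (g \<circ> X))"
      using optimal_coupling[OF assms(1-3) p X g gX_norm Y] by blast
    \<comment> \<open>Along \<open>v\<close> the function \<open>g\<close> gains \<open>K\<close>
      per unit, so this step length carries the value \<open>g (X' \<omega>)\<close> exactly to
      \<open>Y' \<omega>\<close>.\<close>
    define t where "t \<omega> = (Y' \<omega> - g (X' \<omega>)) / K" for \<omega>
    define Z where "Z \<omega> = X' \<omega> + t \<omega> *\<^sub>R v" for \<omega>
    have [measurable]: "t \<in> borel_measurable P" unfolding t_def by measurable
    have Z_meas[measurable]: "Z \<in> borel_measurable P" unfolding Z_def by measurable
    have gZ: "g \<circ> Z = Y'" using K by (auto simp: Z_def v(2) t_def)
    have X'_norm: "X' \<in> Lp_vars P p norm"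
      by (rule Lp_vars_distr_cong[OF X' _ X_norm dX'[symmetric]]) simp
    have "distr P borel (g \<circ> X) = distr P borel (g \<circ> X')" by (simp add: distr_comp dX')
    then have "g \<circ> X' \<in> Lp_vars P p norm"
      using measurable_comp[OF X' g] by (intro Lp_vars_distr_cong[OF _ _ gX_norm]) auto
    moreover have "Y' \<in> Lp_vars P p norm"
      by (rule Lp_vars_distr_cong[OF Y' _ Y dY'[symmetric]]) simp
    ultimately have D: "(\<lambda>\<omega>. Y' \<omega> - g (X' \<omega>)) \<in> Lp_vars P p norm"
      using Lp_vars_diff[of Y' P p "g \<circ> X'"] p by simp
    then have "(\<lambda>\<omega>. t \<omega> *\<^sub>R v) \<in> Lp_vars P p norm"
      by (rule Lp_vars_dominated[of _ _ _ _ _ _ "norm v / K"]) (use p K in \<open>auto simp: t_def mult.commute\<close>)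
    with X'_norm have "Z \<in> Lp_vars P p norm" unfolding Z_def using p by (simp add: Lp_vars_add)
    then have Z: "Z \<in> Lp_vars P p (lnorm a)" using a p by (simp add: Lp_vars_lnorm)
    \<comment> \<open>\<open>(Z, X')\<close> is an admissible coupling because \<open>X'\<close> has
      the law of \<open>X\<close>. Its displacement is \<open>t \<omega>\<close> times a vector of
      length at most 1, so its cost is at most \<open>1 / K\<close> times the optimal
      one-dimensional cost.\<close>
    have "wasserstein P p (lnorm a) (dist_fun P Z) (dist_fun P X)
        \<le> (\<integral>\<omega>. lnorm a (Z \<omega> - X' \<omega>) powr p \<partial>P) powr (1 / p)"
      by (intro wasserstein_le dist_fun_eqI_distr) (simp_all add: dX')
    also have "\<dots> \<le> (\<integral>\<omega>. (1 / K) powr p * \<bar>Y' \<omega> - g (X' \<omega>)\<bar> powr p \<partial>P) powr (1 / p)"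
    proof (intro powr_mono2 integral_mono_AE' AE_I2)
      show "integrable P (\<lambda>\<omega>. (1 / K) powr p * \<bar>Y' \<omega> - g (X' \<omega>)\<bar> powr p)"
        using D by (simp add: Lp_vars_def)
      fix \<omega>
      have "lnorm a (Z \<omega> - X' \<omega>) = \<bar>t \<omega>\<bar> * lnorm a v" by (simp add: Z_def lnorm_scaleR[OF a])
      also have "\<dots> \<le> 1 / K * \<bar>Y' \<omega> - g (X' \<omega>)\<bar>"
        using mult_left_le[OF v(1), of "\<bar>t \<omega>\<bar>"] K by (simp add: t_def)
      finally show "lnorm a (Z \<omega> - X' \<omega>) powr p \<le> (1 / K) powr p * \<bar>Y' \<omega> - g (X' \<omega>)\<bar> powr p"
        using p K by (auto intro!: powr_mono2 simp: lnorm_nonneg simp flip: powr_mult)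
    qed (use p in auto)
    also have "\<dots> = 1 / K * (\<integral>\<omega>. \<bar>Y' \<omega> - g (X' \<omega>)\<bar> powr p \<partial>P) powr (1 / p)"
      using K p by (simp add: powr_mult powr_powr powr_divide)
    also have "\<dots> \<le> \<epsilon>"
      using order_trans[OF cost W] K by (simp add: field_simps)
    finally have "Z \<in> uncertainty_set P p (lnorm a) \<epsilon> X"
      using Z by (simp add: uncertainty_set_def)
    \<comment> \<open>\<open>g \<circ> Z\<close> is \<open>Y'\<close>, which agrees with
      \<open>Y\<close> only in law. This is where the closure under equality in law enters.\<close>
    moreover have "dist_fun P Y = dist_fun P (g \<circ> Z)"
      unfolding gZ by (rule dist_fun_eqI_distr) (simp_all add: dY')
    ultimately show "Y \<in> law_closure P ((\<lambda>Z. g \<circ> Z) ` uncertainty_set P p (lnorm a) \<epsilon> X)"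
      using Y_meas by (auto simp: law_closure_def)
  qed
qed

end
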